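(* Let $r$ be a positive integer and let $q,p$ be nonzero complex numbers with $|p|<1$. The monomials $X_1^{k_1}\cdots X_r^{k_r}$, for $k_1,\dots,k_r\in\mathbb N_0$, form a basis for the algebra $\mathbb C_{q,p}[X_1,\dots,X_r;a_1,\dots,a_r]$ as a left module over $\mathbb E_{q,p}(a_1,\dots,a_r)$. In other words, any element of the algebra can be written uniquely as a finite sum $$\sum_{k_1,\dots,k_r\ge0}c_{k_1,\dots,k_r}X_1^{k_1}\cdots X_r^{k_r}$$ with $c_{k_1,\dots,k_r}\in\mathbb E_{q,p}(a_1,\dots,a_r)$.
   Context: Notation. For $x\in\mathbb C^\times=\mathbb C\setminus\{0\}$ and nonzero complex $p$ with $|p|<1$, let $(x;p)_\infty=\prod_{k\ge0}(1-xp^k)$ and let $\theta(x)=\theta(x;p)=(x;p)_\infty(p/x;p)_\infty$; $\theta(x_1,\dots,x_m)=\prod_{i=1}^m\theta(x_i)$. Field of coefficients. Write $q=e^{2\pi\sqrt{-1}\sigma}$, $p=e^{2\pi\sqrt{-1}\tau}$ with complex $\sigma,\tau$. $\mathbb E_{q,p}(a_1,\dots,a_r)$ denotes the field of totally elliptic functions over $\mathbb C$ in the complex variables $\log_q a_1,\dots,\log_q a_r$, with equal periods $\sigma^{-1}$ and $\tau\sigma^{-1}$ in each variable; i.e. meromorphic functions $f(a_1,\dots,a_r)$ of $a_1,\dots,a_r\in\mathbb C^\times$ that are invariant under $a_i\mapsto pa_i$ for each $i$ separately. Elliptic weights. For indeterminates $a,b$ and integers $s,t$, $$w_{a,b;q,p}(s,t)=\frac{\theta(aq^{s+2t},bq^{2s+t-2},aq^{t-s-1}/b)}{\theta(aq^{s+2t-2},bq^{2s+t},aq^{t-s+1}/b)}\,q.$$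 The algebra. $\mathbb C_{q,p}[X_1,\dots,X_r;a_1,\dots,a_r]$ is the associative unital algebra over $\mathbb C$ generated by noncommuting variables $X_1,\dots,X_r$ together with the coefficient field $\mathbb E_{q,p}(a_1,\dots,a_r)$ (the variables $a_1,\dots,a_r$ commute with each other), subject to the (defining) relations $$X_jX_i=w_{a_i,a_j;q,p}(1,1)\,X_iX_j\quad (1\le i<j\le r),$$ $$X_i\,f(a_1,\dots,a_r)=f(a_1q^2,\dots,a_{i-1}q^2,a_iq,a_{i+1}q^2,\dots,a_rq^2)\,X_i\quad(1\le i\le r)$$ for all $f\in\mathbb E_{q,p}(a_1,\dots,a_r)$. It is a left module over $\mathbb E_{q,p}(a_1,\dots,a_r)$ by left multiplication. *)

theory Defs
  imports "HOL-Analysis.Analysis" "HOL-Algebra.QuotRing" "HOL-Algebra.Module"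
begin

definition torus :: "(complex ^ 'n) set" where
  "torus = {a. \<forall>i. a $ i \<noteq> 0}"

text \<open>The Frechet derivative of HOL-Analysis is only required to be real linear, hence the
  additional condition that it is linear over the complex numbers.\<close>

definition holomorphic_in :: "(complex ^ 'n \<Rightarrow> complex) \<Rightarrow> (complex ^ 'n) set \<Rightarrow> bool" where
  "holomorphic_in f U \<longleftrightarrow>
     (\<forall>z\<in>U. \<exists>D. (f has_derivative D) (at z) \<and> (\<forall>c v. D (c *s v) = c * D v))"

text \<open>Locally a quotient of holomorphic functions whose denominator vanishes identically on no
  nonempty open set. Nothing is required of the values at the zeros of the denominator; they are
  factored out by \<open>mero_eq\<close> below.\<close>

definition meromorphic_torus :: "(complex ^ 'n \<Rightarrow> complex) \<Rightarrow> bool" where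
  "meromorphic_torus f \<longleftrightarrow>
     (\<forall>z\<in>torus. \<exists>U g h. open U \<and> z \<in> U \<and> U \<subseteq> torus \<and>
        holomorphic_in g U \<and> holomorphic_in h U \<and>
        (\<forall>V. open V \<longrightarrow> V \<noteq> {} \<longrightarrow> V \<subseteq> U \<longrightarrow> (\<exists>v\<in>V. h v \<noteq> 0)) \<and>
        (\<forall>v\<in>U. h v \<noteq> 0 \<longrightarrow> f v = g v / h v))"

definition agree_densely :: "(complex ^ 'n \<Rightarrow> complex) \<Rightarrow> (complex ^ 'n \<Rightarrow> complex) \<Rightarrow> bool" where
  "agree_densely f g \<longleftrightarrow>
     (\<exists>D. open D \<and> D \<subseteq> torus \<and> torus \<subseteq> closure D \<and> (\<forall>a\<in>D. f a = g a))"

definition mero_eq :: "(complex ^ 'n \<Rightarrow> complex) \<Rightarrow> (complex ^ 'n \<Rightarrow> complex) \<Rightarrow> bool" where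
  "mero_eq f g \<longleftrightarrow> meromorphic_torus f \<and> meromorphic_torus g \<and> agree_densely f g"

lemma open_torus: "open (torus :: (complex ^ 'n) set)"
proof -
  have "torus = (\<Inter>i. {a :: complex ^ 'n. a $ i \<noteq> 0})"
    by (auto simp: torus_def)
  moreover have "open {a :: complex ^ 'n. a $ i \<noteq> 0}" for i
    by (intro open_Collect_neq continuous_intros)
  then have "open (\<Inter>i. {a :: complex ^ 'n. a $ i \<noteq> 0})" by (intro open_INT) auto
  ultimately show ?thesis by metis
qed

lemma dense_iff:
  fixes D :: "(complex ^ 'n) set"
  shows "torus \<subseteq> closure D \<longleftrightarrow>
     (\<forall>V. open V \<longrightarrow> V \<noteq> {} \<longrightarrow> V \<subseteq> torus \<longrightarrow> V \<inter> D \<noteq> {})"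
proof
  assume D: "torus \<subseteq> closure D"
  show "\<forall>V. open V \<longrightarrow> V \<noteq> {} \<longrightarrow> V \<subseteq> torus \<longrightarrow> V \<inter> D \<noteq> {}"
  proof (intro allI impI)
    fix V :: "(complex ^ 'n) set" assume V: "open V" "V \<noteq> {}" "V \<subseteq> torus"
    then have "V \<inter> closure D \<noteq> {}" using D by blast
    then show "V \<inter> D \<noteq> {}" using open_Int_closure_eq_empty[OF V(1)] by blast
  qed
next
  assume D: "\<forall>V. open V \<longrightarrow> V \<noteq> {} \<longrightarrow> V \<subseteq> torus \<longrightarrow> V \<inter> D \<noteq> {}"
  have "torus \<inter> - closure D = {}"
  proof (rule ccontr)
    assume ne: "torus \<inter> - closure D \<noteq> {}"
    have "open (torus \<inter> - closure D)" by (intro open_Int open_torus) auto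
    then have "(torus \<inter> - closure D) \<inter> D \<noteq> {}" using D ne by blast
    then show False using closure_subset[of D] by blast
  qed
  then show "torus \<subseteq> closure D" by blast
qed

lemma agree_densely_refl: "(\<And>a. a \<in> torus \<Longrightarrow> f a = g a) \<Longrightarrow> agree_densely f g"
  unfolding agree_densely_def using open_torus closure_subset by (intro exI[of _ torus]) auto

lemma agree_densely_sym: "agree_densely f g \<Longrightarrow> agree_densely g f"
  unfolding agree_densely_def by metis

lemma dense_Int:
  fixes D E :: "(complex ^ 'n) set"
  assumes "open D" "torus \<subseteq> closure D" "torus \<subseteq> closure E"
  shows "torus \<subseteq> closure (D \<inter> E)"
  unfolding dense_iff
proof (intro allI impI)
  fix V :: "(complex ^ 'n) set" assume V: "open V" "V \<noteq> {}" "V \<subseteq> torus"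
  have "V \<inter> D \<noteq> {}" "open (V \<inter> D)" "V \<inter> D \<subseteq> torus"
    using V assms(1,2) by (auto simp: dense_iff open_Int)
  then have "(V \<inter> D) \<inter> E \<noteq> {}" using assms(3) unfolding dense_iff by blast
  then show "V \<inter> (D \<inter> E) \<noteq> {}" by blast
qed

lemma agree_densely_lift2:
  assumes "agree_densely f f'" "agree_densely g g'"
    and "\<And>a. f a = f' a \<Longrightarrow> g a = g' a \<Longrightarrow> h a = h' a"
  shows "agree_densely h h'"
proof -
  obtain D E where "open D" "D \<subseteq> torus" "torus \<subseteq> closure D" "\<forall>a\<in>D. f a = f' a"
    "open E" "E \<subseteq> torus" "torus \<subseteq> closure E" "\<forall>a\<in>E. g a = g' a"
    using assms(1,2) unfolding agree_densely_def by metis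
  then show ?thesis
    unfolding agree_densely_def using dense_Int[of D E] assms(3)
    by (intro exI[of _ "D \<inter> E"]) auto
qed

lemma agree_densely_trans: "agree_densely f g \<Longrightarrow> agree_densely g h \<Longrightarrow> agree_densely f h"
  by (erule agree_densely_lift2) auto

lemma agree_densely_uminus: "agree_densely f g \<Longrightarrow> agree_densely (\<lambda>a. - f a) (\<lambda>a. - g a)"
  by (rule agree_densely_lift2[of f g f g]) auto

lemma holomorphic_in_const: "holomorphic_in (\<lambda>_. c) U"
  unfolding holomorphic_in_def by (intro ballI exI[of _ "\<lambda>_. 0"]) auto

lemma holomorphic_in_add:
  assumes "holomorphic_in f U" "holomorphic_in g U"
  shows "holomorphic_in (\<lambda>z. f z + g z) U"
  unfolding holomorphic_in_def
proof
  fix z assume "z \<in> U"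
  then obtain D E where
    "(f has_derivative D) (at z)" "\<forall>c v. D (c *s v) = c * D v"
    "(g has_derivative E) (at z)" "\<forall>c v. E (c *s v) = c * E v"
    using assms unfolding holomorphic_in_def by metis
  then show "\<exists>D. ((\<lambda>z. f z + g z) has_derivative D) (at z) \<and> (\<forall>c v. D (c *s v) = c * D v)"
    by (intro exI[of _ "\<lambda>v. D v + E v"]) (auto intro: has_derivative_add simp: algebra_simps)
qed

lemma holomorphic_in_mult:
  assumes "holomorphic_in f U" "holomorphic_in g U"
  shows "holomorphic_in (\<lambda>z. f z * g z) U"
  unfolding holomorphic_in_def
proof
  fix z assume "z \<in> U"
  then obtain D E where
    "(f has_derivative D) (at z)" "\<forall>c v. D (c *s v) = c * D v"
    "(g has_derivative E) (at z)" "\<forall>c v. E (c *s v) = c * E v"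
    using assms unfolding holomorphic_in_def by metis
  then show "\<exists>D. ((\<lambda>z. f z * g z) has_derivative D) (at z) \<and> (\<forall>c v. D (c *s v) = c * D v)"
    by (intro exI[of _ "\<lambda>v. f z * E v + D v * g z"] conjI has_derivative_mult)
       (auto simp: algebra_simps)
qed

lemma holomorphic_in_subset: "holomorphic_in f U \<Longrightarrow> V \<subseteq> U \<Longrightarrow> holomorphic_in f V"
  unfolding holomorphic_in_def by blast

lemma holomorphic_in_continuous: "holomorphic_in f U \<Longrightarrow> continuous_on U f"
  unfolding holomorphic_in_def
  by (meson has_derivative_continuous continuous_at_imp_continuous_on)

lemma meromorphic_torus_lift2:
  fixes f g :: "complex ^ 'n \<Rightarrow> complex"
  assumes f: "meromorphic_torus f" and g: "meromorphic_torus g"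
    and N: "\<And>(U :: (complex ^ 'n) set) f1 f2 g1 g2. holomorphic_in f1 U \<Longrightarrow> holomorphic_in f2 U \<Longrightarrow>
       holomorphic_in g1 U \<Longrightarrow> holomorphic_in g2 U \<Longrightarrow>
       holomorphic_in (\<lambda>z. N (f1 z) (f2 z) (g1 z) (g2 z)) U"
    and F: "\<And>a b c d :: complex. b \<noteq> 0 \<Longrightarrow> d \<noteq> 0 \<Longrightarrow> F (a / b) (c / d) = N a b c d / (b * d)"
  shows "meromorphic_torus (\<lambda>z. F (f z) (g z))"
  unfolding meromorphic_torus_def
proof
  fix z :: "complex ^ 'n" assume z: "z \<in> torus"
  obtain U f1 f2 where U: "open U" "z \<in> U" "U \<subseteq> torus" "holomorphic_in f1 U" "holomorphic_in f2 U"
    "\<And>V. open V \<Longrightarrow> V \<noteq> {} \<Longrightarrow> V \<subseteq> U \<Longrightarrow> \<exists>v\<in>V. f2 v \<noteq> 0"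
    "\<And>v. v \<in> U \<Longrightarrow> f2 v \<noteq> 0 \<Longrightarrow> f v = f1 v / f2 v"
    using f z unfolding meromorphic_torus_def by metis
  obtain W g1 g2 where W: "open W" "z \<in> W" "W \<subseteq> torus" "holomorphic_in g1 W" "holomorphic_in g2 W"
    "\<And>V. open V \<Longrightarrow> V \<noteq> {} \<Longrightarrow> V \<subseteq> W \<Longrightarrow> \<exists>v\<in>V. g2 v \<noteq> 0"
    "\<And>v. v \<in> W \<Longrightarrow> g2 v \<noteq> 0 \<Longrightarrow> g v = g1 v / g2 v"
    using g z unfolding meromorphic_torus_def by metis
  note hol = holomorphic_in_subset[OF U(4), of "U \<inter> W"] holomorphic_in_subset[OF U(5), of "U \<inter> W"]
    holomorphic_in_subset[OF W(4), of "U \<inter> W"] holomorphic_in_subset[OF W(5), of "U \<inter> W"]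
  have "\<exists>v\<in>V. f2 v * g2 v \<noteq> 0" if V: "open V" "V \<noteq> {}" "V \<subseteq> U \<inter> W" for V
  proof -
    obtain v where v: "v \<in> V" "f2 v \<noteq> 0" using U(6)[of V] V by auto
    have "continuous_on V f2"
      using holomorphic_in_continuous[OF U(5)] V(3) by (meson continuous_on_subset le_inf_iff)
    then have "open (V \<inter> f2 -` (- {0}))"
      using V(1) by (intro continuous_open_preimage) auto
    then obtain w where "w \<in> V \<inter> f2 -` (- {0})" "g2 w \<noteq> 0"
      using W(6)[of "V \<inter> f2 -` (- {0})"] v V(3) by blast
    then show ?thesis by auto
  qed
  moreover have "F (f v) (g v) = N (f1 v) (f2 v) (g1 v) (g2 v) / (f2 v * g2 v)"
    if "v \<in> U \<inter> W" "f2 v * g2 v \<noteq> 0" for v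
    using that U(7)[of v] W(7)[of v] F[of "f2 v" "g2 v"] by auto
  moreover have "holomorphic_in (\<lambda>v. N (f1 v) (f2 v) (g1 v) (g2 v)) (U \<inter> W)"
    "holomorphic_in (\<lambda>v. f2 v * g2 v) (U \<inter> W)"
    using hol by (simp_all add: N holomorphic_in_mult)
  moreover have "open (U \<inter> W)" "z \<in> U \<inter> W" "U \<inter> W \<subseteq> torus"
    using U(1-3) W(1-3) by auto
  ultimately show "\<exists>U n h. open U \<and> z \<in> U \<and> U \<subseteq> torus \<and> holomorphic_in n U \<and> holomorphic_in h U \<and>
        (\<forall>V. open V \<longrightarrow> V \<noteq> {} \<longrightarrow> V \<subseteq> U \<longrightarrow> (\<exists>v\<in>V. h v \<noteq> 0)) \<and>
        (\<forall>v\<in>U. h v \<noteq> 0 \<longrightarrow> F (f v) (g v) = n v / h v)"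
    by (intro exI[of _ "U \<inter> W"] exI[of _ "\<lambda>v. N (f1 v) (f2 v) (g1 v) (g2 v)"]
        exI[of _ "\<lambda>v. f2 v * g2 v"] conjI) simp_all
qed

lemma meromorphic_torus_const: "meromorphic_torus (\<lambda>_. c)"
  unfolding meromorphic_torus_def
  by (intro ballI exI[of _ torus] exI[of _ "\<lambda>_. c"] exI[of _ "\<lambda>_. 1"])
     (auto simp: open_torus intro: holomorphic_in_const)

lemma meromorphic_torus_add:
  "meromorphic_torus f \<Longrightarrow> meromorphic_torus g \<Longrightarrow> meromorphic_torus (\<lambda>z. f z + g z)"
  by (rule meromorphic_torus_lift2[where N = "\<lambda>a b c d. a * d + c * b"])
     (auto intro!: holomorphic_in_add holomorphic_in_mult simp: add_frac_eq)

lemma meromorphic_torus_mult: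
  "meromorphic_torus f \<Longrightarrow> meromorphic_torus g \<Longrightarrow> meromorphic_torus (\<lambda>z. f z * g z)"
  by (rule meromorphic_torus_lift2[where N = "\<lambda>a b c d. a * c"])
     (auto intro!: holomorphic_in_mult)

lemma meromorphic_torus_uminus: "meromorphic_torus f \<Longrightarrow> meromorphic_torus (\<lambda>z. - f z)"
  using meromorphic_torus_mult[OF meromorphic_torus_const[of "- 1"]] by simp

definition scale_vars :: "complex ^ 'n \<Rightarrow> complex ^ 'n \<Rightarrow> complex ^ 'n" where
  "scale_vars s a = (\<chi> i. s $ i * a $ i)"

lemma scale_vars_torus: "s \<in> torus \<Longrightarrow> scale_vars s a \<in> torus \<longleftrightarrow> a \<in> torus"
  by (auto simp: torus_def scale_vars_def)

lemma scale_vars_bounded_linear: "bounded_linear (scale_vars s)"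
  unfolding linear_conv_bounded_linear[symmetric]
  by (rule linearI) (auto simp: scale_vars_def vec_eq_iff algebra_simps)

lemma scale_vars_inverse:
  assumes "s \<in> torus"
  shows "scale_vars (\<chi> i. inverse (s $ i)) (scale_vars s a) = a"
    and "scale_vars s (scale_vars (\<chi> i. inverse (s $ i)) a) = a"
  using assms by (auto simp: scale_vars_def torus_def vec_eq_iff)

lemma scale_vars_vimage: "s \<in> torus \<Longrightarrow> scale_vars s ` V = scale_vars (\<chi> i. inverse (s $ i)) -` V"
  by (force simp: scale_vars_inverse image_iff)

lemma open_scale_vars_vimage: "open V \<Longrightarrow> open (scale_vars s -` V)"
  using scale_vars_bounded_linear linear_continuous_on by (intro open_vimage) auto

lemma open_scale_vars_image: "s \<in> torus \<Longrightarrow> open V \<Longrightarrow> open (scale_vars s ` V)"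
  by (simp add: scale_vars_vimage open_scale_vars_vimage)

lemma holomorphic_in_scale_vars:
  assumes "holomorphic_in f U"
  shows "holomorphic_in (\<lambda>a. f (scale_vars s a)) (scale_vars s -` U)"
  unfolding holomorphic_in_def
proof
  fix z assume "z \<in> scale_vars s -` U"
  then obtain D where D: "(f has_derivative D) (at (scale_vars s z))" "\<forall>c v. D (c *s v) = c * D v"
    using assms unfolding holomorphic_in_def by auto
  have "(scale_vars s has_derivative scale_vars s) (at z)"
    by (rule bounded_linear_imp_has_derivative[OF scale_vars_bounded_linear])
  from diff_chain_at[OF this D(1)]
  have "((\<lambda>a. f (scale_vars s a)) has_derivative (\<lambda>v. D (scale_vars s v))) (at z)"
    by (simp add: o_def)
  moreover have "scale_vars s (c *s v) = c *s scale_vars s v" for c v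
    by (simp add: scale_vars_def vec_eq_iff)
  ultimately show "\<exists>D. ((\<lambda>a. f (scale_vars s a)) has_derivative D) (at z) \<and>
      (\<forall>c v. D (c *s v) = c * D v)"
    using D(2) by (intro exI[of _ "\<lambda>v. D (scale_vars s v)"]) auto
qed

lemma meromorphic_torus_scale_vars:
  assumes f: "meromorphic_torus f" and s: "s \<in> torus"
  shows "meromorphic_torus (\<lambda>a. f (scale_vars s a))"
  unfolding meromorphic_torus_def
proof
  fix z :: "complex ^ 'a" assume z: "z \<in> torus"
  then have "scale_vars s z \<in> torus" using s scale_vars_torus by blast
  then obtain U g h where U: "open U" "scale_vars s z \<in> U" "U \<subseteq> torus"
    "holomorphic_in g U" "holomorphic_in h U"
    "\<And>V. open V \<Longrightarrow> V \<noteq> {} \<Longrightarrow> V \<subseteq> U \<Longrightarrow> \<exists>v\<in>V. h v \<noteq> 0"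
    "\<And>v. v \<in> U \<Longrightarrow> h v \<noteq> 0 \<Longrightarrow> f v = g v / h v"
    using f unfolding meromorphic_torus_def by metis
  let ?U = "scale_vars s -` U"
  have "\<forall>V. open V \<longrightarrow> V \<noteq> {} \<longrightarrow> V \<subseteq> ?U \<longrightarrow> (\<exists>v\<in>V. h (scale_vars s v) \<noteq> 0)"
  proof (intro allI impI)
    fix V assume V: "open V" "V \<noteq> {}" "V \<subseteq> ?U"
    have "\<exists>v\<in>scale_vars s ` V. h v \<noteq> 0"
      using V s by (intro U(6) open_scale_vars_image) auto
    then show "\<exists>v\<in>V. h (scale_vars s v) \<noteq> 0" by blast
  qed
  moreover have "?U \<subseteq> torus"
    using U(3) s scale_vars_torus by blast
  moreover have "open ?U" "z \<in> ?U"
    using U(1,2) by (auto simp: open_scale_vars_vimage)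
  moreover note holomorphic_in_scale_vars[OF U(4), of s] holomorphic_in_scale_vars[OF U(5), of s]
  moreover have "\<forall>v\<in>?U. h (scale_vars s v) \<noteq> 0 \<longrightarrow>
      f (scale_vars s v) = g (scale_vars s v) / h (scale_vars s v)"
    using U(7) by blast
  ultimately show "\<exists>U g h. open U \<and> z \<in> U \<and> U \<subseteq> torus \<and> holomorphic_in g U \<and> holomorphic_in h U \<and>
        (\<forall>V. open V \<longrightarrow> V \<noteq> {} \<longrightarrow> V \<subseteq> U \<longrightarrow> (\<exists>v\<in>V. h v \<noteq> 0)) \<and>
        (\<forall>v\<in>U. h v \<noteq> 0 \<longrightarrow> f (scale_vars s v) = g v / h v)"
    by (intro exI[of _ ?U] exI[of _ "\<lambda>a. g (scale_vars s a)"]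
        exI[of _ "\<lambda>a. h (scale_vars s a)"] conjI)
qed

lemma agree_densely_scale_vars:
  fixes s :: "complex ^ 'n"
  assumes "agree_densely f g" and s: "s \<in> torus"
  shows "agree_densely (\<lambda>a. f (scale_vars s a)) (\<lambda>a. g (scale_vars s a))"
proof -
  obtain D where D: "open D" "D \<subseteq> torus" "torus \<subseteq> closure D" "\<forall>a\<in>D. f a = g a"
    using assms(1) unfolding agree_densely_def by metis
  have "torus \<subseteq> closure (scale_vars s -` D)"
    unfolding dense_iff
  proof (intro allI impI)
    fix V :: "(complex ^ 'n) set" assume V: "open V" "V \<noteq> {}" "V \<subseteq> torus"
    have "scale_vars s ` V \<subseteq> torus" using V(3) s scale_vars_torus by blast
    moreover have "open (scale_vars s ` V)" using V(1) s by (rule open_scale_vars_image[rotated])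
    ultimately have "scale_vars s ` V \<inter> D \<noteq> {}"
      using V(2) D(3) unfolding dense_iff by (meson image_is_empty)
    then show "V \<inter> scale_vars s -` D \<noteq> {}" by blast
  qed
  moreover have "scale_vars s -` D \<subseteq> torus" using D(2) s scale_vars_torus by blast
  ultimately show ?thesis
    unfolding agree_densely_def using D(1,4)
    by (intro exI[of _ "scale_vars s -` D"]) (auto simp: open_scale_vars_vimage)
qed

lemma part_equivp_mero_eq: "part_equivp (mero_eq :: (complex ^ 'n \<Rightarrow> complex) \<Rightarrow> _)"
proof (rule part_equivpI)
  have "mero_eq (\<lambda>_. 0) (\<lambda>_ :: complex ^ 'n. 0)"
    by (simp add: mero_eq_def meromorphic_torus_const agree_densely_refl)
  then show "\<exists>f :: complex ^ 'n \<Rightarrow> complex. mero_eq f f" by blast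
  show "symp (mero_eq :: (complex ^ 'n \<Rightarrow> complex) \<Rightarrow> _)"
    by (auto intro!: sympI simp: mero_eq_def agree_densely_sym)
  show "transp (mero_eq :: (complex ^ 'n \<Rightarrow> complex) \<Rightarrow> _)"
    by (auto intro!: transpI simp: mero_eq_def intro: agree_densely_trans)
qed

text \<open>Meromorphic functions on the torus, as classes modulo agreement on an open dense subset.\<close>

quotient_type 'n mero = "complex ^ ('n::finite) \<Rightarrow> complex" / partial: mero_eq
  by (rule part_equivp_mero_eq)

instantiation mero :: (finite) comm_ring_1
begin

lift_definition zero_mero :: "'a mero" is "\<lambda>_. 0"
  by (simp add: mero_eq_def meromorphic_torus_const agree_densely_refl)

lift_definition one_mero :: "'a mero" is "\<lambda>_. 1"
  by (simp add: mero_eq_def meromorphic_torus_const agree_densely_refl)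

lift_definition plus_mero :: "'a mero \<Rightarrow> 'a mero \<Rightarrow> 'a mero" is "\<lambda>f g a. f a + g a"
  by (auto simp: mero_eq_def intro: meromorphic_torus_add elim: agree_densely_lift2)

lift_definition times_mero :: "'a mero \<Rightarrow> 'a mero \<Rightarrow> 'a mero" is "\<lambda>f g a. f a * g a"
  by (auto simp: mero_eq_def intro: meromorphic_torus_mult elim: agree_densely_lift2)

lift_definition uminus_mero :: "'a mero \<Rightarrow> 'a mero" is "\<lambda>f a. - f a"
  by (auto simp: mero_eq_def intro: meromorphic_torus_uminus agree_densely_uminus)

definition minus_mero :: "'a mero \<Rightarrow> 'a mero \<Rightarrow> 'a mero" where
  "minus_mero f g = f + - g"

instance
proof
  fix f g h :: "'a mero"
  show "f * g * h = f * (g * h)"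
    by transfer (auto simp: mero_eq_def mult.assoc intro!: agree_densely_refl meromorphic_torus_mult)
  show "f * g = g * f"
    by transfer (auto simp: mero_eq_def mult.commute intro!: agree_densely_refl meromorphic_torus_mult)
  show "1 * f = f"
    by transfer (auto simp: mero_eq_def)
  show "f + g + h = f + (g + h)"
    by transfer (auto simp: mero_eq_def add.assoc intro!: agree_densely_refl meromorphic_torus_add)
  show "f + g = g + f"
    by transfer (auto simp: mero_eq_def add.commute intro!: agree_densely_refl meromorphic_torus_add)
  show "0 + f = f"
    by transfer (auto simp: mero_eq_def)
  show "- f + f = 0"
    by transfer (auto simp: mero_eq_def meromorphic_torus_const intro!: agree_densely_refl)
  show "f - g = f + - g"
    by (rule minus_mero_def)
  show "(f + g) * h = f * h + g * h"
    by transfer (auto simp: mero_eq_def distrib_right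
        intro!: agree_densely_refl meromorphic_torus_add meromorphic_torus_mult)
  have "\<not> agree_densely (\<lambda>_. 0) (\<lambda>_ :: complex ^ 'a. 1)"
  proof
    assume "agree_densely (\<lambda>_. 0) (\<lambda>_ :: complex ^ 'a. 1)"
    then have "(torus :: (complex ^ 'a) set) = {}"
      unfolding agree_densely_def by force
    moreover have "(\<chi> i. 1) \<in> (torus :: (complex ^ 'a) set)" by (simp add: torus_def)
    ultimately show False by blast
  qed
  then show "(0 :: 'a mero) \<noteq> 1"
    by transfer (simp add: mero_eq_def)
qed

end

lift_definition const_mero :: "complex \<Rightarrow> 'n::finite mero" is "\<lambda>c _. c"
  by (simp add: mero_eq_def meromorphic_torus_const agree_densely_refl)

text \<open>The substitution \<open>f(a) \<mapsto> f(s a)\<close> (componentwise product) for \<open>s\<close> in the torus. It has no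
  meaning for other \<open>s\<close>, where the definition returns \<open>f\<close>.\<close>

lift_definition rescale :: "complex ^ 'n \<Rightarrow> 'n::finite mero \<Rightarrow> 'n mero" is
  "\<lambda>s f. if s \<in> torus then (\<lambda>a. f (scale_vars s a)) else f"
  by (auto simp: mero_eq_def intro: meromorphic_torus_scale_vars agree_densely_scale_vars)

definition theta :: "complex \<Rightarrow> complex \<Rightarrow> complex" where
  "theta p x = (\<Prod>k. 1 - x * p ^ k) * (\<Prod>k. 1 - (p / x) * p ^ k)"

definition ell_weight :: "complex \<Rightarrow> complex \<Rightarrow> int \<Rightarrow> int \<Rightarrow> complex \<Rightarrow> complex \<Rightarrow> complex" where
  "ell_weight q p s t a b =
     theta p (a * q powi (s + 2 * t)) * theta p (b * q powi (2 * s + t - 2)) *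
       theta p (a * q powi (t - s - 1) / b) /
     (theta p (a * q powi (s + 2 * t - 2)) * theta p (b * q powi (2 * s + t)) *
       theta p (a * q powi (t - s + 1) / b)) * q"

definition ell_field :: "complex \<Rightarrow> 'n::finite mero ring" where
  "ell_field p =
     \<lparr>carrier = {f. \<forall>i. rescale (\<chi> j. if j = i then p else 1) f = f},
      mult = (*), one = 1, zero = 0, add = (+)\<rparr>"

text \<open>For \<open>i \<noteq> j\<close> and nonzero \<open>q\<close>, \<open>p\<close> with \<open>\<bar>p\<bar> < 1\<close> the weight is a quotient of holomorphic
  functions on the torus; its values \<open>x / 0 = 0\<close> at the zeros of the denominator do not affect
  the class.\<close>

definition weight_mero :: "complex \<Rightarrow> complex \<Rightarrow> 'n \<Rightarrow> 'n \<Rightarrow> 'n::finite mero" where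
  "weight_mero q p i j = abs_mero (\<lambda>a. ell_weight q p 1 1 (a $ i) (a $ j))"

definition shift :: "complex \<Rightarrow> 'n \<Rightarrow> 'n::finite mero \<Rightarrow> 'n mero" where
  "shift q i = rescale (\<chi> j. if j = i then q else q ^ 2)"

text \<open>The free unital associative algebra over the complex numbers on a set \<open>G\<close>: finitely supported
  functions on the free monoid of words over \<open>G\<close>.\<close>

definition free_algebra :: "'g set \<Rightarrow> ('g list \<Rightarrow> complex) ring" where
  "free_algebra G =
     \<lparr>carrier = {u. finite {w. u w \<noteq> 0} \<and> {w. u w \<noteq> 0} \<subseteq> lists G},
      mult = (\<lambda>u v w. \<Sum>(x, y) | x @ y = w. u x * v y),
      one = (\<lambda>w. if w = [] then 1 else 0),
      zero = (\<lambda>w. 0),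
      add = (\<lambda>u v w. u w + v w)\<rparr>"

definition word :: "'g list \<Rightarrow> 'g list \<Rightarrow> complex" where
  "word w = (\<lambda>v. if v = w then 1 else 0)"

definition scalar :: "complex \<Rightarrow> 'g list \<Rightarrow> complex" where
  "scalar c = (\<lambda>v. if v = [] then c else 0)"

lemma finite_splits: "finite {(x, y). x @ y = w}"
proof -
  have "{(x, y). x @ y = w} \<subseteq> (\<lambda>n. (take n w, drop n w)) ` {..length w}"
  proof
    fix s assume "s \<in> {(x, y). x @ y = w}"
    then have "s = (take (length (fst s)) w, drop (length (fst s)) w)" "length (fst s) \<le> length w"
      by auto
    then show "s \<in> (\<lambda>n. (take n w, drop n w)) ` {..length w}" by blast
  qed
  then show ?thesis by (rule finite_subset) auto
qed

lemma free_algebra_mult_assoc: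
  fixes u v t :: "'g list \<Rightarrow> complex"
  shows "(\<Sum>(x, y) | x @ y = w. (\<Sum>(a, b) | a @ b = x. u a * v b) * t y) =
         (\<Sum>(x, y) | x @ y = w. u x * (\<Sum>(a, b) | a @ b = y. v a * t b))"
proof -
  have "(\<Sum>(x, y) | x @ y = w. (\<Sum>(a, b) | a @ b = x. u a * v b) * t y) =
        (\<Sum>s\<in>{(x, y). x @ y = w}. \<Sum>r\<in>{(a, b). a @ b = fst s}. u (fst r) * v (snd r) * t (snd s))"
    by (intro sum.cong refl) (auto simp: sum_distrib_right case_prod_unfold)
  also have "\<dots> = (\<Sum>(s, r)\<in>(SIGMA s:{(x, y). x @ y = w}. {(a, b). a @ b = fst s}).
      u (fst r) * v (snd r) * t (snd s))"
    by (rule sum.Sigma) (auto simp: finite_splits)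
  also have "\<dots> = (\<Sum>(s, r)\<in>(SIGMA s:{(x, y). x @ y = w}. {(a, b). a @ b = snd s}).
      u (fst s) * (v (fst r) * t (snd r)))"
    by (rule sum.reindex_bij_witness
        [where i = "\<lambda>((x, y), (a, b)). ((x @ a, b), (x, a))"
           and j = "\<lambda>((x, y), (a, b)). ((a, b @ y), (b, y))"]) auto
  also have "\<dots> = (\<Sum>s\<in>{(x, y). x @ y = w}. \<Sum>r\<in>{(a, b). a @ b = snd s}.
      u (fst s) * (v (fst r) * t (snd r)))"
    by (rule sum.Sigma[symmetric]) (auto simp: finite_splits)
  also have "\<dots> = (\<Sum>(x, y) | x @ y = w. u x * (\<Sum>(a, b) | a @ b = y. v a * t b))"
    by (intro sum.cong refl) (auto simp: sum_distrib_left case_prod_unfold)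
  finally show ?thesis .
qed

lemma free_algebra_mult_support:
  fixes u v :: "'g list \<Rightarrow> complex"
  shows "{w. (\<Sum>(x, y) | x @ y = w. u x * v y) \<noteq> 0} \<subseteq>
    (\<lambda>(x, y). x @ y) ` ({w. u w \<noteq> 0} \<times> {w. v w \<noteq> 0})"
proof
  fix w assume "w \<in> {w. (\<Sum>(x, y) | x @ y = w. u x * v y) \<noteq> 0}"
  then obtain s where s: "s \<in> {(x, y). x @ y = w}" "(case s of (x, y) \<Rightarrow> u x * v y) \<noteq> 0"
    by (metis (mono_tags, lifting) mem_Collect_eq sum.neutral)
  then show "w \<in> (\<lambda>(x, y). x @ y) ` ({w. u w \<noteq> 0} \<times> {w. v w \<noteq> 0})"
    by (auto simp: image_iff)
qed

lemma free_algebra_one_mult: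
  fixes u :: "'g list \<Rightarrow> complex"
  shows "(\<Sum>(x, y) | x @ y = w. (if x = [] then 1 else 0) * u y) = u w"
    and "(\<Sum>(x, y) | x @ y = w. u x * (if y = [] then 1 else 0)) = u w"
proof -
  have "(\<Sum>(x, y) | x @ y = w. (if x = [] then 1 else 0) * u y) =
      (\<Sum>(x, y)\<in>{([] :: 'g list, w)}. (if x = [] then 1 else 0) * u y)"
    by (rule sum.mono_neutral_right) (auto simp: finite_splits split: if_splits)
  then show "(\<Sum>(x, y) | x @ y = w. (if x = [] then 1 else 0) * u y) = u w" by simp
  have "(\<Sum>(x, y) | x @ y = w. u x * (if y = [] then 1 else 0)) =
      (\<Sum>(x, y)\<in>{(w, [] :: 'g list)}. u x * (if y = [] then 1 else 0))"
    by (rule sum.mono_neutral_right) (auto simp: finite_splits split: if_splits)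
  then show "(\<Sum>(x, y) | x @ y = w. u x * (if y = [] then 1 else 0)) = u w" by simp
qed

lemma ring_free_algebra: "ring (free_algebra G)"
proof (rule ringI)
  let ?F = "free_algebra G"
  have supp_add: "{w. u w + v w \<noteq> 0} \<subseteq> {w. u w \<noteq> 0} \<union> {w. v w \<noteq> 0}" for u v :: "'a list \<Rightarrow> complex"
    by auto
  show "abelian_group ?F"
  proof (rule abelian_groupI)
    fix u v assume "u \<in> carrier ?F" "v \<in> carrier ?F"
    then show "u \<oplus>\<^bsub>?F\<^esub> v \<in> carrier ?F"
      using finite_subset[OF supp_add[of u v]] supp_add[of u v] by (auto simp: free_algebra_def)
  next
    fix u assume "u \<in> carrier ?F"
    then show "\<exists>v\<in>carrier ?F. v \<oplus>\<^bsub>?F\<^esub> u = \<zero>\<^bsub>?F\<^esub>"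
      by (intro bexI[of _ "\<lambda>w. - u w"]) (auto simp: free_algebra_def)
  qed (auto simp: free_algebra_def algebra_simps)
  show "Group.monoid ?F"
  proof (rule Group.monoidI)
    fix u v assume uv: "u \<in> carrier ?F" "v \<in> carrier ?F"
    have "(\<lambda>(x, y). x @ y) ` ({w. u w \<noteq> 0} \<times> {w. v w \<noteq> 0}) \<subseteq> lists G"
      using uv unfolding free_algebra_def by fastforce
    moreover have "finite ((\<lambda>(x, y). x @ y) ` ({w. u w \<noteq> 0} \<times> {w. v w \<noteq> 0}))"
      using uv by (auto simp: free_algebra_def)
    ultimately show "u \<otimes>\<^bsub>?F\<^esub> v \<in> carrier ?F"
      using subset_trans[OF free_algebra_mult_support] finite_subset[OF free_algebra_mult_support]
      unfolding free_algebra_def partial_object.simps monoid.simps mem_Collect_eq by blast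
  qed (auto simp: free_algebra_def free_algebra_one_mult free_algebra_mult_assoc)
qed (auto simp: free_algebra_def fun_eq_iff sum.distrib[symmetric] case_prod_unfold algebra_simps)

text \<open>The index set \<open>{1, \<dots>, r}\<close> of the variables is a finite linearly ordered type \<open>'n\<close>.\<close>

datatype 'n gen = Var 'n | Coef "'n::finite mero"

text \<open>Pairs \<open>(u, v)\<close> stand for relations \<open>u = v\<close>. The first three families identify the symbols
  \<^term>\<open>Coef f\<close> with the elements of the coefficient field, viewed as a unital algebra over the
  complex numbers; the last two are the relations involving the variables.\<close>

inductive_set ell_relations ::
    "complex \<Rightarrow> complex \<Rightarrow>
      (('n::{finite,linorder} gen list \<Rightarrow> complex) \<times> ('n gen list \<Rightarrow> complex)) set"
  for q p :: complex
where
  coef_add: "f \<in> carrier (ell_field p) \<Longrightarrow> g \<in> carrier (ell_field p) \<Longrightarrow>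
    (word [Coef (f + g)], \<lambda>w. word [Coef f] w + word [Coef g] w) \<in> ell_relations q p"
| coef_mult: "f \<in> carrier (ell_field p) \<Longrightarrow> g \<in> carrier (ell_field p) \<Longrightarrow>
    (word [Coef (f * g)], word [Coef f, Coef g]) \<in> ell_relations q p"
| coef_const: "(word [Coef (const_mero c)], scalar c) \<in> ell_relations q p"
| var_var: "i < j \<Longrightarrow>
    (word [Var j, Var i], word [Coef (weight_mero q p i j), Var i, Var j]) \<in> ell_relations q p"
| var_coef: "f \<in> carrier (ell_field p) \<Longrightarrow>
    (word [Var i, Coef f], word [Coef (shift q i f), Var i]) \<in> ell_relations q p"

definition ell_free :: "complex \<Rightarrow> ('n::finite gen list \<Rightarrow> complex) ring" where
  "ell_free p = free_algebra (range Var \<union> Coef ` carrier (ell_field p))"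

definition ell_ideal ::
    "complex \<Rightarrow> complex \<Rightarrow> ('n::{finite,linorder} gen list \<Rightarrow> complex) set" where
  "ell_ideal q p = genideal (ell_free p) {u \<ominus>\<^bsub>ell_free p\<^esub> v |u v. (u, v) \<in> ell_relations q p}"

definition ell_gen ::
    "complex \<Rightarrow> complex \<Rightarrow> 'n gen \<Rightarrow> ('n::{finite,linorder} gen list \<Rightarrow> complex) set" where
  "ell_gen q p x = ell_ideal q p +>\<^bsub>ell_free p\<^esub> word [x]"

definition ell_algebra ::
    "complex \<Rightarrow> complex \<Rightarrow> ('n mero, ('n::{finite,linorder} gen list \<Rightarrow> complex) set) module" where
  "ell_algebra q p = (let A = ell_free p Quot ell_ideal q p in
     \<lparr>carrier = carrier A, mult = mult A, one = one A, zero = zero A, add = add A,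
      smult = (\<lambda>f x. ell_gen q p (Coef f) \<otimes>\<^bsub>A\<^esub> x)\<rparr>)"

text \<open>\<open>X\<^sub>1\<^bsup>k\<^sub>1\<^esup> \<cdots> X\<^sub>r\<^bsup>k\<^sub>r\<^esup>\<close>, with the factors in increasing order of the index.\<close>

definition ell_monomial ::
    "complex \<Rightarrow> complex \<Rightarrow> ('n \<Rightarrow> nat) \<Rightarrow> ('n::{finite,linorder} gen list \<Rightarrow> complex) set" where
  "ell_monomial q p k =
     foldr (\<lambda>i y. (ell_gen q p (Var i) [^]\<^bsub>ell_algebra q p\<^esub> k i) \<otimes>\<^bsub>ell_algebra q p\<^esub> y)
       (sorted_list_of_set UNIV) \<one>\<^bsub>ell_algebra q p\<^esub>"

definition fin_coeffs :: "('a, 'c) ring_scheme \<Rightarrow> ('i \<Rightarrow> 'a) set" where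
  "fin_coeffs R = {c. (\<forall>i. c i \<in> carrier R) \<and> finite {i. c i \<noteq> \<zero>\<^bsub>R\<^esub>}}"

definition lin_comb ::
    "('a, 'c) ring_scheme \<Rightarrow> ('a, 'b, 'd) module_scheme \<Rightarrow> ('i \<Rightarrow> 'b) \<Rightarrow> ('i \<Rightarrow> 'a) \<Rightarrow> 'b" where
  "lin_comb R M b c = (\<Oplus>\<^bsub>M\<^esub>i\<in>{i. c i \<noteq> \<zero>\<^bsub>R\<^esub>}. c i \<odot>\<^bsub>M\<^esub> b i)"

definition module_basis ::
    "('a, 'c) ring_scheme \<Rightarrow> ('a, 'b, 'd) module_scheme \<Rightarrow> ('i \<Rightarrow> 'b) \<Rightarrow> bool" where
  "module_basis R M b \<longleftrightarrow>
     module R M \<and> range b \<subseteq> carrier M \<and>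
     (\<forall>x\<in>carrier M. \<exists>c\<in>fin_coeffs R. x = lin_comb R M b c) \<and>
     (\<forall>c\<in>fin_coeffs R. lin_comb R M b c = \<zero>\<^bsub>M\<^esub> \<longrightarrow> (\<forall>i. c i = \<zero>\<^bsub>R\<^esub>))"

end

theory Submission
  imports Defs "HOL-Complex_Analysis.Cauchy_Integral_Formula"
begin

text \<open>
  Write \<open>\<Phi>\<^sub>i\<close> for the substitution \<open>shift q i\<close>, so that the defining relations read
  \<open>X\<^sub>i f = \<Phi>\<^sub>i(f) X\<^sub>i\<close> and \<open>X\<^sub>j X\<^sub>i = w\<^sub>i\<^sub>j X\<^sub>i X\<^sub>j\<close> for \<open>i < j\<close>.

  The monomials span because the relations are rules for normal ordering: they move coefficients
  to the left and a variable past all variables of smaller index, each time at the price of a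
  coefficient. Hence \<open>X\<^sub>j\<close> times an ordered monomial is a coefficient times the ordered monomial
  whose \<open>j\<close>-th exponent is larger by one (\<open>var_mult_monomial\<close>), so the span of the monomials is
  closed under left multiplication by all generators. It contains 1 and therefore everything
  (\<open>carrier_eq_monomial_span\<close>).

  For linear independence it suffices to find a module in which the images of one vector under
  the monomials are visibly independent. Take all families \<open>m\<^sub>k\<close> of meromorphic functions, indexed
  by exponents \<open>k\<close> and thought of as formal sums of \<open>m\<^sub>k z\<^sup>k\<close> in commuting variables \<open>z\<^sub>i\<close>. Let
  coefficients act by multiplication, and let \<open>X\<^sub>i\<close> act as the dressed shift \<open>H\<^sub>i \<Phi>\<^sub>i z\<^sub>i\<close>, where
  \<open>H\<^sub>i\<close> is \<open>\<theta>(q a\<^sub>i)\<close> divided by the product of \<open>\<theta>(a\<^sub>i/a\<^sub>l)\<close> over all \<open>l \<noteq> i\<close>. Every relation is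
  immediate except the one between \<open>X\<^sub>i\<close> and \<open>X\<^sub>j\<close>, which amounts to
  \<open>H\<^sub>j \<Phi>\<^sub>j(H\<^sub>i) = w\<^sub>i\<^sub>j H\<^sub>i \<Phi>\<^sub>i(H\<^sub>j)\<close>: over the ring of all meromorphic functions the weight is
  a coboundary for the shifts, although \<open>H\<^sub>i\<close> itself is not elliptic.
  This identity (\<open>dressing_mero_cocycle\<close>) comes down to
  \<open>\<theta>(1/x) = - \<theta>(x)/x\<close>. It takes the place of a check that all overlaps of the rewriting rules
  are confluent.

  The free algebra thus acts with the ideal of relations in its kernel, and the quotient acts.
  As \<open>H\<^sub>i\<close> is invertible, the monomial with exponents \<open>k\<close> sends the vector \<open>z\<^sup>0\<close> to a unit times
  \<open>z\<^sup>k\<close> (\<open>quot_act_monomial\<close>), so the coefficients of a linear combination can be read off from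
  its effect on \<open>z\<^sup>0\<close> (\<open>lin_comb_inj\<close>).

  The analytic input is that \<open>\<theta>\<close> is holomorphic with countably many zeros, which makes \<open>w\<^sub>i\<^sub>j\<close>
  and \<open>H\<^sub>i\<close> meromorphic and \<open>H\<^sub>i\<close> invertible, and that \<open>\<theta>(p x) = - \<theta>(x)/x\<close>, which puts the
  weights in the field of elliptic functions.
\<close>

section \<open>The theta function\<close>

lemma euler_product_summable:
  fixes p x :: complex
  assumes "norm p < 1"
  shows "summable (\<lambda>k. norm (x * p ^ k))"
  using summable_mult[OF summable_geometric[of "norm p"], of "norm x"] assms
  by (simp add: norm_mult norm_power)

lemma euler_product_convergent:
  fixes p x :: complex
  assumes "norm p < 1"
  shows "convergent_prod (\<lambda>k. 1 - x * p ^ k)"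
proof -
  have "summable (\<lambda>k. norm ((1 - x * p ^ k) - 1))"
    using euler_product_summable[OF assms, of x] by simp
  then show ?thesis
    by (intro abs_convergent_prod_imp_convergent_prod summable_imp_abs_convergent_prod)
qed

lemma euler_product_eq_0_iff:
  fixes p x :: complex
  assumes "norm p < 1"
  shows "(\<Prod>k. 1 - x * p ^ k) = 0 \<longleftrightarrow> (\<exists>k. x * p ^ k = 1)"
proof -
  have "(\<lambda>k. 1 - x * p ^ k) has_prod (\<Prod>k. 1 - x * p ^ k)"
    using euler_product_convergent[OF assms] by (rule convergent_prod_has_prod)
  from has_prod_eq_0_iff[OF this] show ?thesis by (auto simp: image_iff)
qed

text \<open>Comparing partial products instead of dividing by the first factor covers the case \<open>x = 1\<close>, in
  which that factor vanishes.\<close>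
lemma euler_product_split_head:
  fixes p x :: complex
  assumes "norm p < 1"
  shows "(\<Prod>k. 1 - x * p ^ k) = (1 - x) * (\<Prod>k. 1 - (p * x) * p ^ k)"
proof -
  note lim = convergent_prod_LIMSEQ[OF euler_product_convergent[OF assms]]
  have "(\<lambda>n. \<Prod>k\<le>Suc n. 1 - x * p ^ k) = (\<lambda>n. (1 - x) * (\<Prod>k\<le>n. 1 - (p * x) * p ^ k))"
    by (subst prod.atMost_Suc_shift) (simp add: mult_ac)
  moreover have "(\<lambda>n. \<Prod>k\<le>Suc n. 1 - x * p ^ k) \<longlonglongrightarrow> (\<Prod>k. 1 - x * p ^ k)"
    using lim by (rule LIMSEQ_Suc)
  ultimately show ?thesis
    using tendsto_mult[OF tendsto_const[of "1 - x"] lim[of "p * x"]] LIMSEQ_unique by metis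
qed

lemma euler_product_holomorphic:
  fixes p :: complex
  assumes "norm p < 1"
  shows "(\<lambda>x. \<Prod>k. 1 - x * p ^ k) holomorphic_on UNIV"
proof (rule holomorphic_uniform_sequence[of _ "\<lambda>n x. \<Prod>k<n. 1 - x * p ^ k"])
  fix x :: complex
  have "uniformly_convergent_on (cball x 1) (\<lambda>N x. \<Sum>n<N. norm ((1 - x * p ^ n) - 1))"
  proof (rule Weierstrass_m_test')
    show "norm (norm ((1 - y * p ^ n) - 1)) \<le> (norm x + 1) * norm p ^ n" if "y \<in> cball x 1" for n y
    proof -
      have "norm y \<le> norm x + 1"
        using that norm_triangle_ineq2[of y x] by (auto simp: dist_norm norm_minus_commute)
      then show ?thesis by (simp add: norm_mult norm_power mult_right_mono)
    qed
    show "summable (\<lambda>n. (norm x + 1) * norm p ^ n)"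
      using assms by (intro summable_mult summable_geometric) simp
  qed
  then have "uniformly_convergent_on (cball x 1) (\<lambda>N x. \<Prod>n<N. 1 - x * p ^ n)"
    by (rule uniformly_convergent_on_prod'[rotated 2]) (auto intro!: continuous_intros)
  then have "uniform_limit (cball x 1) (\<lambda>n x. \<Prod>k<n. 1 - x * p ^ k)
      (\<lambda>x. lim (\<lambda>n. \<Prod>k<n. 1 - x * p ^ k)) sequentially"
    by (simp add: uniformly_convergent_uniform_limit_iff)
  moreover have "lim (\<lambda>n. \<Prod>k<n. 1 - x * p ^ k) = (\<Prod>k. 1 - x * p ^ k)" for x
    using convergent_prod_LIMSEQ[OF euler_product_convergent[OF assms, of x]]
    by (intro limI) (simp add: LIMSEQ_lessThan_iff_atMost)
  ultimately have lim: "uniform_limit (cball x 1) (\<lambda>n x. \<Prod>k<n. 1 - x * p ^ k)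
      (\<lambda>x. \<Prod>k. 1 - x * p ^ k) sequentially"
    by simp
  show "\<exists>d>0. cball x d \<subseteq> UNIV \<and> uniform_limit (cball x d)
      (\<lambda>n x. \<Prod>k<n. 1 - x * p ^ k) (\<lambda>x. \<Prod>k. 1 - x * p ^ k) sequentially"
    by (intro exI[of _ "1 :: real"] conjI zero_less_one subset_UNIV lim)
next
  show "(\<lambda>x. \<Prod>k<n. 1 - x * p ^ k) holomorphic_on UNIV" for n
    by (intro holomorphic_intros)
qed (rule open_UNIV)

lemma theta_differentiable:
  assumes "norm p < 1" "x \<noteq> 0"
  shows "theta p field_differentiable (at x)"
proof -
  have d: "(\<lambda>x. \<Prod>k. 1 - x * p ^ k) field_differentiable (at y)" for y
    using euler_product_holomorphic[OF assms(1)] by (simp add: holomorphic_on_def)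
  have "(\<lambda>x. p / x) field_differentiable (at x)"
    using assms(2) by (intro derivative_intros) auto
  then have "(\<lambda>x. \<Prod>k. 1 - (p / x) * p ^ k) field_differentiable (at x)"
    using d field_differentiable_compose[of "\<lambda>x. p / x" x "\<lambda>x. \<Prod>k. 1 - x * p ^ k"]
    by (simp add: o_def)
  then show ?thesis
    unfolding theta_def[abs_def] using d by (intro field_differentiable_mult)
qed

text \<open>For \<open>p \<noteq> 0\<close> the zeros are the integral powers of \<open>p\<close>. Countability suffices to keep them
  from filling an open set.\<close>
lemma countable_theta_zeros:
  assumes "norm p < 1"
  shows "countable {x. x \<noteq> 0 \<and> theta p x = 0}"
proof -
  have "{x. x \<noteq> 0 \<and> theta p x = 0} \<subseteq> (\<Union>k. {inverse (p ^ k), p * p ^ k})"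
  proof
    fix x assume "x \<in> {x. x \<noteq> 0 \<and> theta p x = 0}"
    then have x: "x \<noteq> 0" "theta p x = 0" by auto
    then have "(\<exists>k. x * p ^ k = 1) \<or> (\<exists>k. p / x * p ^ k = 1)"
      unfolding theta_def mult_eq_0_iff euler_product_eq_0_iff[OF assms] by blast
    then consider k where "x * p ^ k = 1" | k where "p / x * p ^ k = 1" by blast
    then show "x \<in> (\<Union>k. {inverse (p ^ k), p * p ^ k})"
    proof cases
      case (1 k)
      then have "x = inverse (p ^ k)" by (metis inverse_unique mult.commute)
      then show ?thesis by blast
    next
      case (2 k)
      then have "x = p * p ^ k" using x by (simp add: field_simps)
      then show ?thesis by blast
    qed
  qed
  then show ?thesis
    by (rule countable_subset) (intro countable_UN countable_insert countable_empty countableI_type)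
qed

text \<open>Passing from \<open>x\<close> to \<open>p x\<close> removes the factor \<open>1 - x\<close> from the first product and adds the factor
  \<open>1 - 1/x\<close> to the second one; their ratio is \<open>- 1/x\<close>.\<close>
lemma theta_mult_p:
  assumes "norm p < 1" "p \<noteq> 0" "x \<noteq> 0"
  shows "theta p (p * x) = - theta p x / x"
proof -
  define A where "A = (\<lambda>x. \<Prod>k. 1 - x * p ^ k)"
  have theta: "theta p y = A y * A (p / y)" for y
    by (simp add: theta_def A_def)
  have split: "A y = (1 - y) * A (p * y)" for y
    unfolding A_def by (rule euler_product_split_head[OF assms(1)])
  have "theta p x = (1 - x) * A (p * x) * A (p / x)"
    unfolding theta by (subst split) (rule refl)
  moreover have "theta p (p * x) = A (p * x) * ((1 - 1 / x) * A (p / x))"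
    unfolding theta using assms(2) split[of "1 / x"] by simp
  moreover have "A (p * x) * ((1 - 1 / x) * A (p / x)) = - ((1 - x) * A (p * x) * A (p / x)) / x"
    using assms(3) by (simp add: divide_simps) (simp add: algebra_simps)
  ultimately show ?thesis by simp
qed

text \<open>The two products of \<open>\<theta>\<close> trade places under \<open>x \<mapsto> p/x\<close>, so that \<open>\<theta>(1/x) = \<theta>(p x)\<close>.\<close>
lemma theta_inverse:
  assumes "norm p < 1" "p \<noteq> 0" "x \<noteq> 0"
  shows "theta p (1 / x) = - theta p x / x"
proof -
  have "p / (1 / x) = p * x" "p / (p * x) = 1 / x" using assms by auto
  then have "theta p (1 / x) = theta p (p * x)"
    unfolding theta_def by (simp only: mult.commute)
  then show ?thesis using theta_mult_p[OF assms] by simp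
qed

section \<open>Denominators of meromorphic functions on the torus\<close>

text \<open>The holomorphic functions that can serve as denominators of meromorphic functions on the whole
  torus. The condition is phrased with open sets, as in \<^const>\<open>meromorphic_torus\<close>, and is
  therefore stable under products without an appeal to the identity theorem.\<close>
definition generically_nonzero :: "(complex ^ 'n \<Rightarrow> complex) \<Rightarrow> bool" where
  "generically_nonzero h \<longleftrightarrow> holomorphic_in h torus \<and>
     (\<forall>V. open V \<longrightarrow> V \<noteq> {} \<longrightarrow> V \<subseteq> torus \<longrightarrow> (\<exists>v\<in>V. h v \<noteq> 0))"

lemma generically_nonzeroD:
  assumes "generically_nonzero h"
  shows "holomorphic_in h torus"
    and "open V \<Longrightarrow> V \<noteq> {} \<Longrightarrow> V \<subseteq> torus \<Longrightarrow> \<exists>v\<in>V. h v \<noteq> 0"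
  using assms unfolding generically_nonzero_def by blast+

lemma open_nonzero_set:
  assumes "holomorphic_in h torus" "open V" "V \<subseteq> torus"
  shows "open {v \<in> V. h v \<noteq> 0}"
proof -
  have "continuous_on V h"
    using holomorphic_in_continuous[OF assms(1)] assms(3) by (rule continuous_on_subset)
  then have "open (V \<inter> h -` (- {0}))"
    using assms(2) by (intro continuous_open_preimage) auto
  moreover have "V \<inter> h -` (- {0}) = {v \<in> V. h v \<noteq> 0}" by auto
  ultimately show ?thesis by simp
qed

lemma generically_nonzero_const: "c \<noteq> 0 \<Longrightarrow> generically_nonzero (\<lambda>_. c)"
  by (auto simp: generically_nonzero_def holomorphic_in_const)

lemma generically_nonzero_mult:
  assumes g: "generically_nonzero g" and h: "generically_nonzero h"
  shows "generically_nonzero (\<lambda>a. g a * h a)"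
  unfolding generically_nonzero_def
proof (intro conjI allI impI)
  show "holomorphic_in (\<lambda>a. g a * h a) torus"
    using generically_nonzeroD(1) g h by (intro holomorphic_in_mult)
  fix V :: "(complex ^ 'a) set" assume V: "open V" "V \<noteq> {}" "V \<subseteq> torus"
  have "open {v \<in> V. g v \<noteq> 0}"
    using generically_nonzeroD(1)[OF g] V(1,3) by (rule open_nonzero_set)
  moreover have "{v \<in> V. g v \<noteq> 0} \<noteq> {}"
    using generically_nonzeroD(2)[OF g V] by auto
  moreover have "{v \<in> V. g v \<noteq> 0} \<subseteq> torus" using V(3) by auto
  ultimately have "\<exists>v\<in>{v \<in> V. g v \<noteq> 0}. h v \<noteq> 0"
    by (rule generically_nonzeroD(2)[OF h])
  then show "\<exists>v\<in>V. g v * h v \<noteq> 0" by auto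
qed

lemma generically_nonzero_prod:
  assumes "finite I" "\<And>i. i \<in> I \<Longrightarrow> generically_nonzero (h i)"
  shows "generically_nonzero (\<lambda>a. \<Prod>i\<in>I. h i a)"
  using assms
proof (induction I rule: finite_induct)
  case empty
  show ?case by (simp add: generically_nonzero_const)
next
  case (insert i I)
  then show ?case using generically_nonzero_mult[of "h i" "\<lambda>a. \<Prod>i\<in>I. h i a"] by simp
qed

text \<open>An identity between meromorphic functions only needs to be checked where finitely many chosen
  denominators do not vanish.\<close>
lemma agree_densely_generic:
  assumes "generically_nonzero h" "\<And>a. a \<in> torus \<Longrightarrow> h a \<noteq> 0 \<Longrightarrow> f a = g a"
  shows "agree_densely f g"
  unfolding agree_densely_def
proof (intro exI conjI ballI)
  show "open {v \<in> torus. h v \<noteq> 0}"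
    using open_nonzero_set[OF generically_nonzeroD(1)[OF assms(1)] open_torus] by simp
  show "torus \<subseteq> closure {v \<in> torus. h v \<noteq> 0}"
    unfolding dense_iff using generically_nonzeroD(2)[OF assms(1)] by blast
qed (use assms(2) in auto)

lemma meromorphic_torus_quotient:
  assumes "holomorphic_in g torus" "generically_nonzero h"
  shows "meromorphic_torus (\<lambda>a. g a / h a)"
  unfolding meromorphic_torus_def
  using assms open_torus unfolding generically_nonzero_def
  by (intro ballI exI[of _ torus] exI[of _ g] exI[of _ h]) auto

lemma holomorphic_in_compose:
  assumes "holomorphic_in m U" "\<And>a. a \<in> U \<Longrightarrow> g field_differentiable (at (m a))"
  shows "holomorphic_in (\<lambda>a. g (m a)) U"
  unfolding holomorphic_in_def
proof
  fix z assume z: "z \<in> U"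
  then obtain D where D: "(m has_derivative D) (at z)" "\<forall>c v. D (c *s v) = c * D v"
    using assms(1) unfolding holomorphic_in_def by blast
  obtain d where "(g has_field_derivative d) (at (m z))"
    using assms(2)[OF z] unfolding field_differentiable_def by blast
  then have "(g has_derivative (*) d) (at (m z))" by (simp add: has_field_derivative_def)
  then have "((\<lambda>a. g (m a)) has_derivative (\<lambda>v. d * D v)) (at z)"
    using diff_chain_at[OF D(1)] by (simp add: o_def)
  then show "\<exists>D. ((\<lambda>a. g (m a)) has_derivative D) (at z) \<and> (\<forall>c v. D (c *s v) = c * D v)"
    using D(2) by (intro exI[of _ "\<lambda>v. d * D v"]) auto
qed

lemma holomorphic_in_component: "holomorphic_in (\<lambda>a. a $ i) U"
  unfolding holomorphic_in_def
  by (intro ballI exI[of _ "\<lambda>v. v $ i"])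
     (auto intro!: bounded_linear_imp_has_derivative bounded_linear_vec_nth)

lemma holomorphic_in_inverse_component: "holomorphic_in (\<lambda>a. inverse (a $ i)) torus"
  by (rule holomorphic_in_compose[OF holomorphic_in_component])
     (auto simp: torus_def intro!: derivative_intros)

text \<open>Along the curve that scales the \<open>i\<close>-th coordinate of a point by \<open>t\<close>, the argument of \<open>\<theta>\<close> is a
  nonzero multiple of \<open>t\<close>. So \<open>\<theta>\<close> vanishes only for countably many \<open>t\<close>, while uncountably many
  points of the curve lie in a given neighbourhood.\<close>
lemma generically_nonzero_theta:
  fixes m :: "complex ^ 'n \<Rightarrow> complex"
  assumes p: "norm p < 1"
    and m: "holomorphic_in m torus" "\<And>a. a \<in> torus \<Longrightarrow> m a \<noteq> 0"
    and scale: "\<And>a t. m (scale_vars (\<chi> j. if j = i then t else 1) a) = t * m a"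
  shows "generically_nonzero (\<lambda>a. theta p (m a))"
  unfolding generically_nonzero_def
proof (intro conjI allI impI)
  show "holomorphic_in (\<lambda>a. theta p (m a)) torus"
    using m(1) by (rule holomorphic_in_compose) (use p m(2) theta_differentiable in blast)
next
  fix V :: "(complex ^ 'n) set" assume V: "open V" "V \<noteq> {}" "V \<subseteq> torus"
  obtain v where v: "v \<in> V" using V(2) by (meson all_not_in_conv)
  define \<sigma> where "\<sigma> = (\<lambda>t. scale_vars (\<chi> j. if j = i then t else 1) v)"
  have "continuous_on UNIV \<sigma>"
    unfolding \<sigma>_def scale_vars_def
  proof (rule continuous_on_vec_lambda)
    show "continuous_on UNIV (\<lambda>t. (\<chi> j. if j = i then t else 1) $ k * v $ k)" for k
      by (cases "k = i") (auto intro!: continuous_intros)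
  qed
  then have "open (\<sigma> -` V)" using V(1) by (intro open_vimage)
  moreover have "1 \<in> \<sigma> -` V"
  proof -
    have "\<sigma> 1 = v" by (simp add: \<sigma>_def scale_vars_def vec_eq_iff)
    then show ?thesis using v by simp
  qed
  ultimately obtain e where e: "e > 0" "ball 1 e \<subseteq> \<sigma> -` V" by (meson open_contains_ball)
  define B where "B = (\<lambda>x. x / m v) ` {x. x \<noteq> 0 \<and> theta p x = 0} \<union> {0}"
  have "countable B" unfolding B_def using countable_theta_zeros[OF p] by simp
  moreover have "uncountable (ball (1 :: complex) e)" using e(1) by (rule uncountable_ball)
  ultimately have "\<not> ball 1 e \<subseteq> B" by (metis countable_subset)
  then obtain t where t: "t \<in> ball 1 e" "t \<notin> B" by blast
  have "m v \<noteq> 0" using m(2) v V(3) by blast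
  then have "t = (t * m v) / m v" "t * m v \<noteq> 0" using t(2) by (auto simp: B_def)
  then have "theta p (t * m v) \<noteq> 0" using t(2) unfolding B_def by blast
  then have "theta p (m (\<sigma> t)) \<noteq> 0" by (simp add: \<sigma>_def scale)
  then show "\<exists>v\<in>V. theta p (m v) \<noteq> 0" using t(1) e(2) by blast
qed

lemma generically_nonzero_theta_component:
  assumes "norm p < 1" "c \<noteq> 0"
  shows "generically_nonzero (\<lambda>a. theta p (a $ i * c))"
  by (rule generically_nonzero_theta[OF assms(1), where i = i])
     (use assms(2) in \<open>auto intro!: holomorphic_in_mult holomorphic_in_component
        holomorphic_in_const simp: torus_def scale_vars_def\<close>)

lemma generically_nonzero_theta_ratio:
  assumes "norm p < 1" "c \<noteq> 0" "i \<noteq> j"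
  shows "generically_nonzero (\<lambda>a. theta p (a $ i * c / a $ j))"
  by (rule generically_nonzero_theta[OF assms(1), where i = i])
     (use assms(2,3) in \<open>auto intro!: holomorphic_in_mult holomorphic_in_component
        holomorphic_in_const holomorphic_in_inverse_component
        simp: divide_inverse\<close>, auto simp: torus_def scale_vars_def)

section \<open>The ring of meromorphic functions\<close>

lemma abs_mero_eqI:
  "meromorphic_torus f \<Longrightarrow> meromorphic_torus g \<Longrightarrow> agree_densely f g \<Longrightarrow> abs_mero f = abs_mero g"
  by (rule Quotient3_rel_abs[OF Quotient3_mero]) (simp add: mero_eq_def)

lemma mero_eq_refl: "meromorphic_torus f \<Longrightarrow> mero_eq f f"
  by (simp add: mero_eq_def agree_densely_refl)

text \<open>The quotient defining \<^typ>\<open>'n mero\<close> is partial, so representatives have to be chosen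
  meromorphic.\<close>
lemma mero_cases:
  obtains f where "meromorphic_torus f" "x = abs_mero f"
proof
  show "meromorphic_torus (rep_mero x)"
    using Quotient3_rep_reflp[OF Quotient3_mero, of x] by (simp add: mero_eq_def)
  show "x = abs_mero (rep_mero x)"
    using Quotient3_abs_rep[OF Quotient3_mero, of x] by simp
qed

lemma abs_mero_plus:
  "meromorphic_torus f \<Longrightarrow> meromorphic_torus g \<Longrightarrow> abs_mero f + abs_mero g = abs_mero (\<lambda>a. f a + g a)"
  by (simp add: plus_mero.abs_eq mero_eq_refl)

lemma abs_mero_times:
  "meromorphic_torus f \<Longrightarrow> meromorphic_torus g \<Longrightarrow> abs_mero f * abs_mero g = abs_mero (\<lambda>a. f a * g a)"
  by (simp add: times_mero.abs_eq mero_eq_refl)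

lemma rescale_abs_mero:
  "s \<in> torus \<Longrightarrow> meromorphic_torus f \<Longrightarrow> rescale s (abs_mero f) = abs_mero (\<lambda>a. f (scale_vars s a))"
  by (simp add: rescale.abs_eq mero_eq_refl)

lemma rescale_not_torus: "s \<notin> torus \<Longrightarrow> rescale s f = f"
  by transfer simp

lemma rescale_add: "rescale s (f + g) = rescale s f + rescale s g"
proof (cases "s \<in> torus")
  case True
  obtain f' where "meromorphic_torus f'" "f = abs_mero f'" by (rule mero_cases)
  moreover obtain g' where "meromorphic_torus g'" "g = abs_mero g'" by (rule mero_cases)
  ultimately show ?thesis
    using True by (simp add: abs_mero_plus rescale_abs_mero meromorphic_torus_add
        meromorphic_torus_scale_vars)
qed (simp add: rescale_not_torus)

lemma rescale_mult: "rescale s (f * g) = rescale s f * rescale s g"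
proof (cases "s \<in> torus")
  case True
  obtain f' where "meromorphic_torus f'" "f = abs_mero f'" by (rule mero_cases)
  moreover obtain g' where "meromorphic_torus g'" "g = abs_mero g'" by (rule mero_cases)
  ultimately show ?thesis
    using True by (simp add: abs_mero_times rescale_abs_mero meromorphic_torus_mult
        meromorphic_torus_scale_vars)
qed (simp add: rescale_not_torus)

lemma rescale_const: "rescale s (const_mero c) = const_mero c"
  by transfer (simp add: mero_eq_refl meromorphic_torus_const)

lemma rescale_commute: "rescale s (rescale t f) = rescale t (rescale s f)"
proof (cases "s \<in> torus \<and> t \<in> torus")
  case True
  obtain g where g: "meromorphic_torus g" "f = abs_mero g" by (rule mero_cases)
  have "scale_vars t (scale_vars s a) = scale_vars s (scale_vars t a)" for a
    by (simp add: scale_vars_def vec_eq_iff)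
  then show ?thesis
    using True g by (simp add: rescale_abs_mero meromorphic_torus_scale_vars)
next
  case False
  then show ?thesis by (auto simp: rescale_not_torus)
qed

lemma const_mero_add: "const_mero (b + c) = const_mero b + const_mero c"
  by transfer (simp add: mero_eq_refl meromorphic_torus_const)

lemma const_mero_mult: "const_mero (b * c) = const_mero b * const_mero c"
  by transfer (simp add: mero_eq_refl meromorphic_torus_const)

lemma const_mero_0: "const_mero 0 = 0"
  by transfer (simp add: mero_eq_refl meromorphic_torus_const)

lemma const_mero_1: "const_mero 1 = 1"
  by transfer (simp add: mero_eq_refl meromorphic_torus_const)

section \<open>The weights and the dressing functions\<close>

lemma theta_div_p:
  assumes "norm p < 1" "p \<noteq> 0" "x \<noteq> 0"
  shows "theta p (x / p) = - (x / p) * theta p x"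
  using theta_mult_p[of p "x / p"] assms by (simp add: field_simps)

lemma ell_weight_1_1:
  "ell_weight q p 1 1 a b =
    theta p (a * q ^ 3) * theta p (b * q) * theta p (a * inverse q / b) * q /
    (theta p (a * q) * theta p (b * q ^ 3) * theta p (a * q / b))"
  by (simp add: ell_weight_def power_int_minus)

text \<open>By quasi-periodicity numerator and denominator of the weight are multiplied by the same factor.\<close>
lemma ell_weight_elliptic:
  assumes p: "norm p < 1" "p \<noteq> 0" and nz: "q \<noteq> 0" "a \<noteq> 0" "b \<noteq> 0"
  shows "ell_weight q p 1 1 (p * a) b = ell_weight q p 1 1 a b"
    and "ell_weight q p 1 1 a (p * b) = ell_weight q p 1 1 a b"
proof -
  have up: "theta p (p * a * c) = - theta p (a * c) / (a * c)" if "a \<noteq> 0" "c \<noteq> 0" for a c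
    using theta_mult_p[OF p, of "a * c"] that by (simp add: mult.assoc)
  have up': "theta p (p * a * c / b) = - theta p (a * c / b) / (a * c / b)" if "c \<noteq> 0" for c
    using up[of a "c / b"] that nz by simp
  have down: "theta p (a * c / (p * b)) = - (a * c / b / p) * theta p (a * c / b)" if "c \<noteq> 0" for c
    using theta_div_p[OF p, of "a * c / b"] that nz by (simp add: mult.commute)
  \<comment> \<open>The factors by which the theta functions change cancel, whatever the values of the
    theta functions.\<close>
  have alg_a: "(- A / (a * q ^ 3)) * B * (- C / (a * inverse q / b)) * q /
      ((- D / (a * q)) * F * (- G / (a * q / b))) = A * B * C * q / (D * F * G)"
    for A B C D F G :: complex
  proof -
    define k where "k = a * q ^ 3 * (a * inverse q / b)"
    have k: "k \<noteq> 0" "k = a * q * (a * q / b)"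
      using nz by (simp_all add: k_def power3_eq_cube)
    have "(- A / (a * q ^ 3)) * B * (- C / (a * inverse q / b)) * q = (A * B * C * q) / k"
      by (simp add: k_def)
    moreover have "(- D / (a * q)) * F * (- G / (a * q / b)) = (D * F * G) / k"
      by (simp add: k(2))
    ultimately show ?thesis using k(1) by simp
  qed
  have alg_b: "A * (- B / (b * q)) * (- (a * inverse q / b / p) * C) * q /
      (D * (- F / (b * q ^ 3)) * (- (a * q / b / p) * G)) = A * B * C * q / (D * F * G)"
    for A B C D F G :: complex
  proof -
    define k where "k = a * inverse q / b / p / (b * q)"
    have k: "k \<noteq> 0" "k = a * q / b / p / (b * q ^ 3)"
      using nz p(2) by (simp_all add: k_def power3_eq_cube field_simps)
    have "A * (- B / (b * q)) * (- (a * inverse q / b / p) * C) * q = (A * B * C * q) * k"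
      by (simp add: k_def divide_inverse mult_ac)
    moreover have "D * (- F / (b * q ^ 3)) * (- (a * q / b / p) * G) = (D * F * G) * k"
      by (simp add: k(2) divide_inverse mult_ac)
    ultimately show ?thesis using k(1) by simp
  qed
  show "ell_weight q p 1 1 (p * a) b = ell_weight q p 1 1 a b"
    unfolding ell_weight_1_1 using nz by (simp only: up up' power_not_zero nonzero_imp_inverse_nonzero
      alg_a not_False_eq_True simp_thms)
  show "ell_weight q p 1 1 a (p * b) = ell_weight q p 1 1 a b"
    unfolding ell_weight_1_1 using nz by (simp only: up down power_not_zero nonzero_imp_inverse_nonzero
      alg_b not_False_eq_True simp_thms)
qed

text \<open>The factor \<open>H\<^sub>i\<close> that turns the shift \<open>\<Phi>\<^sub>i\<close> into the operator representing \<open>X\<^sub>i\<close>.\<close>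
definition dressing :: "complex \<Rightarrow> complex \<Rightarrow> 'n \<Rightarrow> complex ^ 'n \<Rightarrow> complex" where
  "dressing q p i a = theta p (a $ i * q) / (\<Prod>l\<in>UNIV - {i}. theta p (a $ i / a $ l))"

text \<open>The shift at \<open>j\<close> multiplies \<open>a\<^sub>i\<close> by \<open>q\<^sup>2\<close> and \<open>a\<^sub>j\<close> by \<open>q\<close>. It therefore turns \<open>\<theta>(q a\<^sub>i)\<close> into
  \<open>\<theta>(q\<^sup>3 a\<^sub>i)\<close> and multiplies \<open>x = a\<^sub>i/a\<^sub>j\<close> by \<open>q\<close>, but fixes the ratios \<open>a\<^sub>i/a\<^sub>l\<close> for all other
  \<open>l\<close>, whose theta functions (collected in \<open>P\<close>) drop out of the comparison. What remains is
  \<open>\<theta>(x) \<theta>(q/x) / (\<theta>(1/x) \<theta>(q x)) = q \<theta>(x/q) / \<theta>(q x)\<close>, by two applications of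
  \<open>theta_inverse\<close>.\<close>
lemma dressing_cocycle:
  fixes a :: "complex ^ 'n"
  assumes p: "norm p < 1" "p \<noteq> 0" and q: "q \<noteq> 0" and ij: "i \<noteq> j" and a: "a \<in> torus"
    and nz: "theta p (a $ i * q) \<noteq> 0" "theta p (a $ j * q ^ 3) \<noteq> 0"
      "theta p (a $ i * inverse q / a $ j) \<noteq> 0"
  defines "s \<equiv> \<lambda>i. \<chi> j. if j = i then q else q ^ 2"
  shows "dressing q p j a * dressing q p i (scale_vars (s j) a) =
    ell_weight q p 1 1 (a $ i) (a $ j) * (dressing q p i a * dressing q p j (scale_vars (s i) a))"
proof -
  define P where "P = (\<lambda>k. \<Prod>l\<in>UNIV - {i, j}. theta p (a $ k / a $ l))"
  have a0: "a $ l \<noteq> 0" for l using a by (simp add: torus_def)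
  have split: "UNIV - {i} = insert j (UNIV - {i, j})" "UNIV - {j} = insert i (UNIV - {i, j})"
    using ij by auto
  let ?x = "a $ i / a $ j"
  have H: "dressing q p i a = theta p (a $ i * q) / (theta p ?x * P i)"
    "dressing q p j a = theta p (a $ j * q) / (theta p (1 / ?x) * P j)"
    unfolding dressing_def split P_def by simp_all
  have "(\<Prod>l\<in>UNIV - {i, j}. theta p (scale_vars (s j) a $ i / scale_vars (s j) a $ l)) = P i"
    "(\<Prod>l\<in>UNIV - {i, j}. theta p (scale_vars (s i) a $ j / scale_vars (s i) a $ l)) = P j"
    unfolding P_def using ij q by (auto intro!: prod.cong simp: scale_vars_def s_def)
  then have S: "dressing q p i (scale_vars (s j) a) = theta p (a $ i * q ^ 3) / (theta p (a $ i * q / a $ j) * P i)"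
    "dressing q p j (scale_vars (s i) a) = theta p (a $ j * q ^ 3) / (theta p (a $ j * q / a $ i) * P j)"
    unfolding dressing_def split using ij q
    by (simp_all add: scale_vars_def s_def power2_eq_square power3_eq_cube mult_ac)
  have T1: "theta p (1 / ?x) = - theta p ?x / ?x"
    using a0 by (intro theta_inverse p) auto
  have T2: "theta p (a $ j * q / a $ i) =
      - theta p (a $ i * inverse q / a $ j) / (a $ i * inverse q / a $ j)"
    using theta_inverse[OF p, of "a $ i * inverse q / a $ j"] a0 q by (simp add: field_simps)
  \<comment> \<open>Here \<open>t\<close>, \<open>u\<close> and \<open>T\<close> stand for \<open>\<theta>(x)\<close>, \<open>\<theta>(x/q)\<close> and \<open>\<theta>(q x)\<close>, and \<open>y\<close> for \<open>x/q\<close>. Zeros of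
    \<open>t\<close>, \<open>T\<close>, \<open>Pi\<close> and \<open>Pj\<close> are harmless: they occur in the denominators of both sides.\<close>
  have alg: "B1 / (- t / x * Pj) * (A3 / (T * Pi)) =
      A3 * B1 * u * q / (A1 * B3 * T) * (A1 / (t * Pi) * (B3 / (- u / y * Pj)))"
    if "A1 \<noteq> 0" "B3 \<noteq> 0" "u \<noteq> 0" "y \<noteq> 0" "x = y * q" for A1 A3 B1 B3 Pi Pj T t u x y :: complex
  proof -
    have "B1 / (- t / x * Pj) * (A3 / (T * Pi)) = - (B1 * A3 * x) / (t * T * Pi * Pj)"
      by (simp add: mult_ac)
    moreover have "A3 * B1 * u * q / (A1 * B3 * T) * (A1 / (t * Pi) * (B3 / (- u / y * Pj))) =
        - (B1 * A3 * (y * q)) / (t * T * Pi * Pj) * ((A1 * B3 * u) / (A1 * B3 * u))"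
      by (simp add: mult_ac)
    ultimately show ?thesis using that by simp
  qed
  show ?thesis
    unfolding H S ell_weight_1_1 T1 T2
    by (rule alg) (use nz a0 q in auto)
qed

lemma meromorphic_weight:
  assumes "norm p < 1" "q \<noteq> 0" "i \<noteq> j"
  shows "meromorphic_torus (\<lambda>a. ell_weight q p 1 1 (a $ i) (a $ j))"
proof -
  have "holomorphic_in (\<lambda>a. theta p (a $ i * q ^ 3) * theta p (a $ j * q) *
      theta p (a $ i * inverse q / a $ j) * q) torus"
    using assms by (intro holomorphic_in_mult holomorphic_in_const
      generically_nonzeroD(1)[OF generically_nonzero_theta_component]
      generically_nonzeroD(1)[OF generically_nonzero_theta_ratio]) auto
  moreover have "generically_nonzero (\<lambda>a. theta p (a $ i * q) * theta p (a $ j * q ^ 3) *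
      theta p (a $ i * q / a $ j))"
    using assms by (intro generically_nonzero_mult generically_nonzero_theta_component
      generically_nonzero_theta_ratio) auto
  ultimately show ?thesis
    unfolding ell_weight_1_1 by (rule meromorphic_torus_quotient)
qed

lemma dressing_generic:
  assumes "norm p < 1" "q \<noteq> 0"
  shows "generically_nonzero (\<lambda>a. theta p (a $ i * q))"
    and "generically_nonzero (\<lambda>a. \<Prod>l\<in>UNIV - {i}. theta p (a $ i / a $ l))"
proof -
  show "generically_nonzero (\<lambda>a. theta p (a $ i * q))"
    using assms by (rule generically_nonzero_theta_component)
  have "generically_nonzero (\<lambda>a. theta p (a $ i / a $ l))" if "l \<in> UNIV - {i}" for l
    using generically_nonzero_theta_ratio[OF assms(1), of 1 i l] that by simp
  then show "generically_nonzero (\<lambda>a. \<Prod>l\<in>UNIV - {i}. theta p (a $ i / a $ l))"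
    by (intro generically_nonzero_prod) auto
qed

lemma meromorphic_dressing:
  assumes "norm p < 1" "q \<noteq> 0"
  shows "meromorphic_torus (dressing q p i)"
  unfolding dressing_def[abs_def]
  by (intro meromorphic_torus_quotient generically_nonzeroD(1) dressing_generic[OF assms])

definition dressing_mero :: "complex \<Rightarrow> complex \<Rightarrow> 'n \<Rightarrow> 'n::finite mero" where
  "dressing_mero q p i = abs_mero (dressing q p i)"

lemma dressing_mero_unit:
  assumes "norm p < 1" "q \<noteq> 0"
  shows "dressing_mero q p i dvd 1"
proof -
  let ?n = "\<lambda>a. theta p (a $ i * q)" and ?d = "\<lambda>a. \<Prod>l\<in>UNIV - {i}. theta p (a $ i / a $ l)"
  note gen = dressing_generic[OF assms, of i]
  have mero: "meromorphic_torus (\<lambda>a. ?n a / ?d a)" "meromorphic_torus (\<lambda>a. ?d a / ?n a)"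
    by (intro meromorphic_torus_quotient generically_nonzeroD(1) gen)+
  have "agree_densely (\<lambda>a. (?n a / ?d a) * (?d a / ?n a)) (\<lambda>_. 1)"
    by (rule agree_densely_generic[OF generically_nonzero_mult[OF gen]]) simp
  then have "abs_mero (\<lambda>a. ?n a / ?d a) * abs_mero (\<lambda>a. ?d a / ?n a) = 1"
    unfolding abs_mero_times[OF mero] one_mero_def
    by (rule abs_mero_eqI[OF meromorphic_torus_mult[OF mero] meromorphic_torus_const])
  then show ?thesis
    unfolding dressing_mero_def dressing_def[abs_def] by (intro dvdI) (rule sym)
qed

lemma shift_torus:
  assumes "q \<noteq> 0"
  shows "(\<chi> j. if j = i then q else q ^ 2) \<in> torus"
  using assms by (simp add: torus_def)

text \<open>The compatibility that makes the operators \<open>H\<^sub>i \<Phi>\<^sub>i z\<^sub>i\<close> satisfy the relation between two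
  variables.\<close>
lemma dressing_mero_cocycle:
  fixes i j :: "'n::finite"
  assumes p: "norm p < 1" "p \<noteq> 0" and q: "q \<noteq> 0" and ij: "i \<noteq> j"
  shows "dressing_mero q p j * shift q j (dressing_mero q p i) =
    weight_mero q p i j * (dressing_mero q p i * shift q i (dressing_mero q p j))"
proof -
  let ?h = "\<lambda>a. theta p (a $ i * q) * theta p (a $ j * q ^ 3) * theta p (a $ i * inverse q / a $ j)"
  have "generically_nonzero ?h"
    using p q ij by (intro generically_nonzero_mult generically_nonzero_theta_component
      generically_nonzero_theta_ratio) auto
  note dense = agree_densely_generic[OF this]
  define s where "s = (\<lambda>i :: 'n. (\<chi> j. if j = i then q else q ^ 2) :: complex ^ 'n)"
  have s_eq: "(\<chi> j. if j = k then q else q ^ 2) = s k" for k by (simp add: s_def)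
  have s: "s k \<in> torus" for k unfolding s_def using q by (rule shift_torus)
  have H: "meromorphic_torus (dressing q p k)" for k :: 'n
    using p(1) q by (rule meromorphic_dressing)
  have HS: "meromorphic_torus (\<lambda>a. dressing q p k (scale_vars (s l) a))" for k l
    using H s by (rule meromorphic_torus_scale_vars)
  have w: "meromorphic_torus (\<lambda>a. ell_weight q p 1 1 (a $ i) (a $ j))"
    using p(1) q ij by (rule meromorphic_weight)
  have "agree_densely (\<lambda>a. dressing q p j a * dressing q p i (scale_vars (s j) a))
      (\<lambda>a. ell_weight q p 1 1 (a $ i) (a $ j) *
        (dressing q p i a * dressing q p j (scale_vars (s i) a)))"
    unfolding s_def by (rule dense, rule dressing_cocycle) (use p q ij in auto)
  then show ?thesis
    unfolding dressing_mero_def weight_mero_def shift_def s_eq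
      rescale_abs_mero[OF s H] abs_mero_times[OF H HS]
      abs_mero_times[OF w meromorphic_torus_mult[OF H HS]]
    by (intro abs_mero_eqI meromorphic_torus_mult H HS w)
qed

lemma weight_mero_elliptic:
  assumes p: "norm p < 1" "p \<noteq> 0" and q: "q \<noteq> 0" and ij: "i \<noteq> j"
  shows "weight_mero q p i j \<in> carrier (ell_field p)"
proof -
  have "rescale (\<chi> j. if j = l then p else 1) (weight_mero q p i j) = weight_mero q p i j" for l
  proof -
    let ?s = "\<chi> j. if j = l then p else 1"
    have s: "?s \<in> torus" using p(2) by (simp add: torus_def)
    note mero = meromorphic_weight[OF p(1) q ij]
    have "ell_weight q p 1 1 (scale_vars ?s a $ i) (scale_vars ?s a $ j) =
        ell_weight q p 1 1 (a $ i) (a $ j)" if "a \<in> torus" for a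
      using ell_weight_elliptic[OF p q] that ij by (auto simp: torus_def scale_vars_def)
    then show ?thesis
      unfolding weight_mero_def rescale_abs_mero[OF s mero]
      by (intro abs_mero_eqI mero meromorphic_torus_scale_vars[OF mero s] agree_densely_refl)
  qed
  then show ?thesis by (simp add: ell_field_def)
qed

section \<open>The action of the free algebra by dressed shifts\<close>

lemma shift_add: "shift q i (f + g) = shift q i f + shift q i g"
  by (simp add: shift_def rescale_add)

lemma shift_mult: "shift q i (f * g) = shift q i f * shift q i g"
  by (simp add: shift_def rescale_mult)

lemma shift_const: "shift q i (const_mero c) = const_mero c"
  by (simp add: shift_def rescale_const)

lemma shift_0: "shift q i 0 = 0"
  using shift_const[of q i 0] by (simp add: const_mero_0)

lemma shift_1: "shift q i 1 = 1"
  using shift_const[of q i 1] by (simp add: const_mero_1)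

lemma shift_commute: "shift q i (shift q j f) = shift q j (shift q i f)"
  by (simp add: shift_def rescale_commute)

lemma shift_unit: "f dvd 1 \<Longrightarrow> shift q i f dvd 1"
  by (metis dvd_def shift_1 shift_mult)

lemma shift_sum: "shift q i (\<Sum>s\<in>S. f s) = (\<Sum>s\<in>S. shift q i (f s))"
  by (induction S rule: infinite_finite_induct) (simp_all add: shift_0 shift_add)

lemma const_mero_sum: "const_mero (\<Sum>s\<in>S. f s) = (\<Sum>s\<in>S. const_mero (f s))"
  by (induction S rule: infinite_finite_induct) (simp_all add: const_mero_0 const_mero_add)

text \<open>A function \<open>m\<close> on exponents stands for the formal sum of \<open>m\<^sub>k z\<^sup>k\<close>, and \<open>X\<^sub>i\<close> acts as
  \<open>H\<^sub>i \<Phi>\<^sub>i z\<^sub>i\<close>. The sums may be infinite, which saves all bookkeeping of supports.\<close>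
fun act_gen :: "complex \<Rightarrow> complex \<Rightarrow> 'n::finite gen \<Rightarrow> (('n \<Rightarrow> nat) \<Rightarrow> 'n mero) \<Rightarrow> ('n \<Rightarrow> nat) \<Rightarrow> 'n mero"
where
  "act_gen q p (Var i) m k =
     (if k i = 0 then 0 else dressing_mero q p i * shift q i (m (k(i := k i - 1))))"
| "act_gen q p (Coef f) m k = f * m k"

definition act_word ::
    "complex \<Rightarrow> complex \<Rightarrow> 'n::finite gen list \<Rightarrow> (('n \<Rightarrow> nat) \<Rightarrow> 'n mero) \<Rightarrow> ('n \<Rightarrow> nat) \<Rightarrow> 'n mero"
where
  "act_word q p w m = foldr (act_gen q p) w m"

definition act ::
    "complex \<Rightarrow> complex \<Rightarrow> ('n::finite gen list \<Rightarrow> complex) \<Rightarrow>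
      (('n \<Rightarrow> nat) \<Rightarrow> 'n mero) \<Rightarrow> ('n \<Rightarrow> nat) \<Rightarrow> 'n mero"
where
  "act q p u m k = (\<Sum>w | u w \<noteq> 0. const_mero (u w) * act_word q p w m k)"

lemma act_word_Nil: "act_word q p [] m = m"
  by (simp add: act_word_def)

lemma act_word_Cons: "act_word q p (x # w) m = act_gen q p x (act_word q p w m)"
  by (simp add: act_word_def)

lemma act_word_append: "act_word q p (v @ w) m = act_word q p v (act_word q p w m)"
  by (simp add: act_word_def)

lemma act_gen_linear:
  "act_gen q p x (\<lambda>k. \<Sum>s\<in>S. const_mero (c s) * m s k) =
    (\<lambda>k. \<Sum>s\<in>S. const_mero (c s) * act_gen q p x (m s) k)"
proof (rule ext)
  fix k
  show "act_gen q p x (\<lambda>k. \<Sum>s\<in>S. const_mero (c s) * m s k) k =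
    (\<Sum>s\<in>S. const_mero (c s) * act_gen q p x (m s) k)"
    by (cases x) (simp_all add: shift_sum shift_mult shift_const sum_distrib_left mult.left_commute)
qed

lemma act_word_linear:
  "act_word q p w (\<lambda>k. \<Sum>s\<in>S. const_mero (c s) * m s k) =
    (\<lambda>k. \<Sum>s\<in>S. const_mero (c s) * act_word q p w (m s) k)"
  by (induction w) (simp_all add: act_word_Nil act_word_Cons act_gen_linear)

lemma act_superset:
  assumes "finite S" "{w. u w \<noteq> 0} \<subseteq> S"
  shows "act q p u m k = (\<Sum>w\<in>S. const_mero (u w) * act_word q p w m k)"
  unfolding act_def using assms
  by (intro sum.mono_neutral_left) (auto simp: const_mero_0)

lemma act_zero: "act q p (\<lambda>w. 0) m k = 0"
  by (simp add: act_def)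

lemma act_scaled_word: "act q p (\<lambda>v. if v = w then c else 0) m k = const_mero c * act_word q p w m k"
proof -
  have "act q p (\<lambda>v. if v = w then c else 0) m k =
      (\<Sum>v\<in>{w}. const_mero (if v = w then c else 0) * act_word q p v m k)"
    by (rule act_superset) auto
  then show ?thesis by simp
qed

lemma act_word_eq: "act q p (word w) m k = act_word q p w m k"
  unfolding word_def act_scaled_word by (simp add: const_mero_1)

lemma act_scalar: "act q p (scalar c) m k = const_mero c * m k"
  unfolding scalar_def act_scaled_word by (simp add: act_word_Nil)

lemma act_add:
  assumes "finite {w. u w \<noteq> 0}" "finite {w. v w \<noteq> 0}"
  shows "act q p (\<lambda>w. u w + v w) m k = act q p u m k + act q p v m k"
proof -
  let ?S = "{w. u w \<noteq> 0} \<union> {w. v w \<noteq> 0}"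
  have S: "finite ?S" using assms by simp
  have "act q p (\<lambda>w. u w + v w) m k = (\<Sum>w\<in>?S. const_mero (u w + v w) * act_word q p w m k)"
    using S by (rule act_superset) auto
  also have "\<dots> = (\<Sum>w\<in>?S. const_mero (u w) * act_word q p w m k) +
      (\<Sum>w\<in>?S. const_mero (v w) * act_word q p w m k)"
    by (simp add: const_mero_add distrib_right sum.distrib)
  also have "(\<Sum>w\<in>?S. const_mero (u w) * act_word q p w m k) = act q p u m k"
    using S by (intro act_superset[symmetric]) auto
  also have "(\<Sum>w\<in>?S. const_mero (v w) * act_word q p w m k) = act q p v m k"
    using S by (intro act_superset[symmetric]) auto
  finally show ?thesis .
qed

lemma act_mult:
  assumes u: "finite {w. u w \<noteq> 0}" and v: "finite {w. v w \<noteq> 0}"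
  shows "act q p (\<lambda>w. \<Sum>(x, y) | x @ y = w. u x * v y) m = act q p u (act q p v m)"
proof (rule ext)
  fix k
  let ?U = "{w. u w \<noteq> 0}" and ?V = "{w. v w \<noteq> 0}"
  let ?app = "\<lambda>(x, y). x @ y"
  let ?t = "\<lambda>(x, y). const_mero (u x) * (const_mero (v y) * act_word q p x (act_word q p y m) k)"
  have fin: "finite (?U \<times> ?V)" using u v by simp
  \<comment> \<open>The contribution of a word \<open>w\<close> is spread over its splittings into words of the two supports;
    summing over \<open>w\<close> then amounts to summing over all pairs of words.\<close>
  have coeff: "const_mero (\<Sum>(x, y) | x @ y = w. u x * v y) * act_word q p w m k =
      (\<Sum>s\<in>{s \<in> ?U \<times> ?V. ?app s = w}. ?t s)" for w
  proof -
    have "(\<Sum>(x, y) | x @ y = w. u x * v y) = (\<Sum>(x, y)\<in>{s \<in> ?U \<times> ?V. ?app s = w}. u x * v y)"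
      by (rule sum.mono_neutral_right) (auto simp: finite_splits)
    then show ?thesis
      by (auto simp: const_mero_sum const_mero_mult sum_distrib_right act_word_append mult.assoc
          intro!: sum.cong)
  qed
  have "act q p (\<lambda>w. \<Sum>(x, y) | x @ y = w. u x * v y) m k =
      (\<Sum>w\<in>?app ` (?U \<times> ?V). const_mero (\<Sum>(x, y) | x @ y = w. u x * v y) * act_word q p w m k)"
    by (rule act_superset) (use fin free_algebra_mult_support in auto)
  also have "\<dots> = (\<Sum>w\<in>?app ` (?U \<times> ?V). \<Sum>s\<in>{s \<in> ?U \<times> ?V. ?app s = w}. ?t s)"
    by (simp only: coeff)
  also have "\<dots> = (\<Sum>s\<in>?U \<times> ?V. ?t s)"
    using fin by (intro sum.group) auto
  also have "\<dots> = (\<Sum>x\<in>?U. \<Sum>y\<in>?V. ?t (x, y))"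
    by (simp add: sum.cartesian_product)
  also have "\<dots> = (\<Sum>x\<in>?U. const_mero (u x) * act_word q p x (act q p v m) k)"
    unfolding act_def[of q p v, abs_def] act_word_linear by (simp add: sum_distrib_left)
  finally show "act q p (\<lambda>w. \<Sum>(x, y) | x @ y = w. u x * v y) m k = act q p u (act q p v m) k"
    unfolding act_def[of q p u] .
qed

section \<open>The coefficient field\<close>

lemma ell_field_carrier_iff:
  "f \<in> carrier (ell_field p) \<longleftrightarrow> (\<forall>i. rescale (\<chi> j. if j = i then p else 1) f = f)"
  by (simp add: ell_field_def)

lemma ell_field_const: "const_mero c \<in> carrier (ell_field p)"
  by (simp add: ell_field_carrier_iff rescale_const)

lemma ell_field_0: "0 \<in> carrier (ell_field p)"
  using ell_field_const[of 0 p] by (simp add: const_mero_0)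

lemma ell_field_1: "1 \<in> carrier (ell_field p)"
  using ell_field_const[of 1 p] by (simp add: const_mero_1)

lemma ell_field_add:
  "f \<in> carrier (ell_field p) \<Longrightarrow> g \<in> carrier (ell_field p) \<Longrightarrow> f + g \<in> carrier (ell_field p)"
  by (simp add: ell_field_carrier_iff rescale_add)

lemma ell_field_mult:
  "f \<in> carrier (ell_field p) \<Longrightarrow> g \<in> carrier (ell_field p) \<Longrightarrow> f * g \<in> carrier (ell_field p)"
  by (simp add: ell_field_carrier_iff rescale_mult)

lemma ell_field_shift:
  "f \<in> carrier (ell_field p) \<Longrightarrow> shift q i f \<in> carrier (ell_field p)"
  unfolding ell_field_carrier_iff shift_def by (subst rescale_commute) simp

lemma ell_field_ops:
  "\<zero>\<^bsub>ell_field p\<^esub> = 0" "\<one>\<^bsub>ell_field p\<^esub> = 1"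
  "f \<oplus>\<^bsub>ell_field p\<^esub> g = f + g" "f \<otimes>\<^bsub>ell_field p\<^esub> g = f * g"
  by (simp_all add: ell_field_def)

lemma cring_ell_field: "cring (ell_field p :: 'n::finite mero ring)"
proof (rule cringI)
  show "abelian_group (ell_field p :: 'n mero ring)"
  proof (rule abelian_groupI)
    fix f assume f: "f \<in> carrier (ell_field p :: 'n mero ring)"
    have "const_mero (- 1) * f + f = (const_mero (- 1) + const_mero 1) * f"
      by (simp add: const_mero_1 distrib_right)
    also have "const_mero (- 1) + const_mero 1 = (0 :: 'n mero)"
      unfolding const_mero_add[symmetric] by (simp add: const_mero_0)
    finally have "const_mero (- 1) * f + f = 0" by simp
    then show "\<exists>g\<in>carrier (ell_field p). g \<oplus>\<^bsub>ell_field p\<^esub> f = \<zero>\<^bsub>ell_field p\<^esub>"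
      using ell_field_mult[OF ell_field_const f] unfolding ell_field_ops by blast
  qed (simp_all add: ell_field_ops ell_field_add ell_field_0 add_ac)
  show "comm_monoid (ell_field p :: 'n mero ring)"
    by (rule comm_monoidI) (simp_all add: ell_field_ops ell_field_mult ell_field_1 mult_ac)
qed (simp add: ell_field_ops distrib_right)

section \<open>Free algebras\<close>

lemma free_algebra_ops:
  "\<zero>\<^bsub>free_algebra G\<^esub> = (\<lambda>w. 0)" "\<one>\<^bsub>free_algebra G\<^esub> = word []"
  "u \<oplus>\<^bsub>free_algebra G\<^esub> v = (\<lambda>w. u w + v w)"
  "u \<otimes>\<^bsub>free_algebra G\<^esub> v = (\<lambda>w. \<Sum>(x, y) | x @ y = w. u x * v y)"
  by (simp_all add: free_algebra_def word_def fun_eq_iff)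

lemma free_algebra_finite_support: "u \<in> carrier (free_algebra G) \<Longrightarrow> finite {w. u w \<noteq> 0}"
  by (simp add: free_algebra_def)

lemma scaled_word_closed:
  assumes "w \<in> lists G"
  shows "(\<lambda>v. if v = w then c else 0) \<in> carrier (free_algebra G)"
proof -
  have "{v. (if v = w then c else 0) \<noteq> 0} \<subseteq> {w}" by auto
  moreover from this have "finite {v. (if v = w then c else 0) \<noteq> 0}" by (rule finite_subset) simp
  ultimately show ?thesis
    using assms unfolding free_algebra_def by (simp only: partial_object.simps) blast
qed

lemma word_closed: "w \<in> lists G \<Longrightarrow> word w \<in> carrier (free_algebra G)"
  unfolding word_def by (rule scaled_word_closed)

lemma scalar_closed: "scalar c \<in> carrier (free_algebra G)"
  unfolding scalar_def by (rule scaled_word_closed) simp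

lemma scalar_mult_word:
  fixes w :: "'g list"
  shows "scalar c \<otimes>\<^bsub>free_algebra G\<^esub> word w = (\<lambda>v. if v = w then c else 0)"
proof
  fix v
  have "(\<Sum>(x, y) | x @ y = v. scalar c x * word w y) = (\<Sum>(x, y)\<in>{([] :: 'g list, v)}. scalar c x * word w y)"
    by (rule sum.mono_neutral_right) (auto simp: finite_splits scalar_def split: if_splits)
  then show "(scalar c \<otimes>\<^bsub>free_algebra G\<^esub> word w) v = (if v = w then c else 0)"
    by (simp add: free_algebra_ops scalar_def word_def)
qed

lemma word_mult_word: "word v \<otimes>\<^bsub>free_algebra G\<^esub> word w = word (v @ w)"
proof
  fix z
  have "(\<Sum>(x, y) | x @ y = z. word v x * word w y) =
      (\<Sum>(x, y)\<in>(if z = v @ w then {(v, w)} else {}). word v x * word w y)"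
    by (rule sum.mono_neutral_right) (auto simp: finite_splits word_def split: if_splits)
  then show "(word v \<otimes>\<^bsub>free_algebra G\<^esub> word w) z = word (v @ w) z"
    by (simp add: free_algebra_ops word_def)
qed

text \<open>Every element is a finite sum of scalar multiples of words.\<close>
lemma free_algebra_induct [consumes 1, case_names zero add]:
  assumes "u \<in> carrier (free_algebra G)"
    and zero: "P (\<lambda>w. 0)"
    and add: "\<And>c w v. w \<in> lists G \<Longrightarrow> v \<in> carrier (free_algebra G) \<Longrightarrow> P v \<Longrightarrow>
      P ((scalar c \<otimes>\<^bsub>free_algebra G\<^esub> word w) \<oplus>\<^bsub>free_algebra G\<^esub> v)"
  shows "P u"
proof -
  have "P u" if "finite S" "{w. u w \<noteq> 0} \<subseteq> S" "S \<subseteq> lists G" for S u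
    using that
  proof (induction S arbitrary: u rule: finite_induct)
    case empty
    then have "u = (\<lambda>w. 0)" by auto
    then show ?case using zero by simp
  next
    case (insert w S)
    let ?v = "u(w := 0)"
    have v: "{w. ?v w \<noteq> 0} \<subseteq> S" using insert.prems(1) by auto
    then have "finite {w. ?v w \<noteq> 0}" "{w. ?v w \<noteq> 0} \<subseteq> lists G"
      using insert.hyps(1) insert.prems(2) by (metis finite_subset, meson insert_subset subset_trans)
    then have "?v \<in> carrier (free_algebra G)" by (simp add: free_algebra_def)
    moreover have "P ?v" by (rule insert.IH[OF v]) (use insert.prems(2) in simp)
    ultimately have "P ((scalar (u w) \<otimes>\<^bsub>free_algebra G\<^esub> word w) \<oplus>\<^bsub>free_algebra G\<^esub> ?v)"
      using insert.prems(2) by (intro add) auto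
    also have "(scalar (u w) \<otimes>\<^bsub>free_algebra G\<^esub> word w) \<oplus>\<^bsub>free_algebra G\<^esub> ?v = u"
      unfolding scalar_mult_word unfolding free_algebra_ops by auto
    finally show ?case .
  qed
  from this[of "{w. u w \<noteq> 0}" u] show ?thesis
    using assms(1) by (simp add: free_algebra_def)
qed

section \<open>The relations act trivially\<close>

lemma act_minus:
  assumes "u \<in> carrier (free_algebra G)" "v \<in> carrier (free_algebra G)"
  shows "act q p (u \<ominus>\<^bsub>free_algebra G\<^esub> v) m k = act q p u m k - act q p v m k"
proof -
  interpret ring "free_algebra G" by (rule ring_free_algebra)
  have d: "u \<ominus>\<^bsub>free_algebra G\<^esub> v \<in> carrier (free_algebra G)" using assms by simp
  have "u = (u \<ominus>\<^bsub>free_algebra G\<^esub> v) \<oplus>\<^bsub>free_algebra G\<^esub> v"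
    using assms by (simp add: a_minus_def a_assoc l_neg)
  then have "act q p u m k = act q p (u \<ominus>\<^bsub>free_algebra G\<^esub> v) m k + act q p v m k"
    using act_add[OF free_algebra_finite_support[OF d] free_algebra_finite_support[OF assms(2)]]
    unfolding free_algebra_ops(3) by metis
  then show ?thesis by simp
qed

definition act_kernel :: "complex \<Rightarrow> complex \<Rightarrow> ('n::finite gen list \<Rightarrow> complex) set" where
  "act_kernel q p = {u \<in> carrier (ell_free p). \<forall>m k. act q p u m k = 0}"

text \<open>The annihilator of the whole module, hence a two-sided ideal.\<close>
lemma ideal_act_kernel: "ideal (act_kernel q p) (ell_free p :: ('n::finite gen list \<Rightarrow> complex) ring)"
proof -
  let ?F = "ell_free p :: ('n gen list \<Rightarrow> complex) ring"
  note F = ell_free_def[of p]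
  interpret ring ?F unfolding F by (rule ring_free_algebra)
  note fin = free_algebra_finite_support
  show ?thesis
  proof (rule idealI)
    show "ring ?F" ..
    show "subgroup (act_kernel q p) (add_monoid ?F)"
    proof (rule add.subgroupI)
      show "act_kernel q p \<subseteq> carrier ?F" by (auto simp: act_kernel_def)
      have "\<zero>\<^bsub>?F\<^esub> \<in> act_kernel q p"
        using zero_closed by (simp add: act_kernel_def F free_algebra_ops act_zero)
      then show "(act_kernel q p :: ('n gen list \<Rightarrow> complex) set) \<noteq> {}" by blast
    next
      fix u :: "'n gen list \<Rightarrow> complex" assume u: "u \<in> act_kernel q p"
      then have uc: "u \<in> carrier ?F" by (simp add: act_kernel_def)
      have "\<ominus>\<^bsub>?F\<^esub> u = \<zero>\<^bsub>?F\<^esub> \<ominus>\<^bsub>?F\<^esub> u" using uc by (simp add: a_minus_def)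
      moreover have "act q p (\<zero>\<^bsub>?F\<^esub> \<ominus>\<^bsub>?F\<^esub> u) m k = 0" for m k
      proof -
        have "act q p (\<zero>\<^bsub>?F\<^esub> \<ominus>\<^bsub>?F\<^esub> u) m k = act q p \<zero>\<^bsub>?F\<^esub> m k - act q p u m k"
          using zero_closed uc unfolding F by (rule act_minus)
        also have "act q p \<zero>\<^bsub>?F\<^esub> m k = 0" unfolding F free_algebra_ops by (rule act_zero)
        finally show ?thesis using u by (simp add: act_kernel_def)
      qed
      ultimately show "\<ominus>\<^bsub>?F\<^esub> u \<in> act_kernel q p" using uc by (simp add: act_kernel_def)
    next
      fix u v :: "'n gen list \<Rightarrow> complex" assume uv: "u \<in> act_kernel q p" "v \<in> act_kernel q p"
      then have c: "u \<in> carrier ?F" "v \<in> carrier ?F" by (simp_all add: act_kernel_def)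
      then have "act q p (u \<oplus>\<^bsub>?F\<^esub> v) m k = act q p u m k + act q p v m k" for m k
        unfolding F free_algebra_ops(3) by (intro act_add fin)
      then show "u \<oplus>\<^bsub>?F\<^esub> v \<in> act_kernel q p"
        using uv c by (simp add: act_kernel_def)
    qed
  next
    fix u x :: "'n gen list \<Rightarrow> complex" assume u: "u \<in> act_kernel q p" and x: "x \<in> carrier ?F"
    then have uc: "u \<in> carrier ?F" and z: "act q p u m = (\<lambda>k. 0)" for m
      by (auto simp: act_kernel_def)
    have "act_word q p w (\<lambda>k. 0) = (\<lambda>k. 0)" for w :: "'n gen list"
      using act_word_linear[of q p w "\<lambda>_. 0" "\<lambda>_ _. 0" "{}"] by simp
    then have "act q p x (\<lambda>k. 0) = (\<lambda>k. 0)" by (simp add: act_def fun_eq_iff)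
    then have "act q p (x \<otimes>\<^bsub>?F\<^esub> u) m = (\<lambda>k. 0)" "act q p (u \<otimes>\<^bsub>?F\<^esub> x) m = (\<lambda>k. 0)" for m
      using uc x unfolding F free_algebra_ops(4) by (simp_all add: act_mult fin z)
    then show "x \<otimes>\<^bsub>?F\<^esub> u \<in> act_kernel q p" "u \<otimes>\<^bsub>?F\<^esub> x \<in> act_kernel q p"
      using uc x by (simp_all add: act_kernel_def)
  qed
qed

lemma ell_relations_closed:
  fixes u v :: "'n::{finite,linorder} gen list \<Rightarrow> complex"
  assumes q: "q \<noteq> 0" and p: "p \<noteq> 0" "norm p < 1" and rel: "(u, v) \<in> ell_relations q p"
  shows "u \<in> carrier (ell_free p)" "v \<in> carrier (ell_free p)"
proof -
  let ?F = "ell_free p :: ('n gen list \<Rightarrow> complex) ring"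
  interpret ring ?F unfolding ell_free_def by (rule ring_free_algebra)
  have word: "word w \<in> carrier ?F"
    if "set w \<subseteq> range Var \<union> Coef ` carrier (ell_field p)" for w :: "'n gen list"
    unfolding ell_free_def using that by (intro word_closed) auto
  have add: "(\<lambda>w. u w + v w) \<in> carrier ?F"
    if "u \<in> carrier ?F" "v \<in> carrier ?F" for u v :: "'n gen list \<Rightarrow> complex"
    using a_closed[OF that] unfolding ell_free_def free_algebra_ops .
  have scalar: "scalar c \<in> carrier ?F" for c
    unfolding ell_free_def by (rule scalar_closed)
  have "u \<in> carrier ?F \<and> v \<in> carrier ?F"
    using rel
  proof (cases rule: ell_relations.cases)
    case (coef_add f g)
    then show ?thesis unfolding coef_add by (intro conjI word add) (auto simp: ell_field_add)
  next
    case (coef_mult f g)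
    then show ?thesis unfolding coef_mult by (intro conjI word) (auto simp: ell_field_mult)
  next
    case (coef_const c)
    then show ?thesis unfolding coef_const by (intro conjI word scalar) (auto simp: ell_field_const)
  next
    case (var_var i j)
    then have "weight_mero q p i j \<in> carrier (ell_field p)"
      by (intro weight_mero_elliptic p q) simp
    then show ?thesis unfolding var_var by (intro conjI word) auto
  next
    case (var_coef f i)
    then show ?thesis unfolding var_coef by (intro conjI word) (auto simp: ell_field_shift)
  qed
  then show "u \<in> carrier ?F" "v \<in> carrier ?F" by auto
qed

lemma act_relation:
  fixes u v :: "'n::{finite,linorder} gen list \<Rightarrow> complex"
  assumes q: "q \<noteq> 0" and p: "p \<noteq> 0" "norm p < 1" and rel: "(u, v) \<in> ell_relations q p"
  shows "act q p u = act q p v"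
proof (intro ext)
  fix m :: "('n \<Rightarrow> nat) \<Rightarrow> 'n mero" and k
  show "act q p u m k = act q p v m k"
    using rel
  proof (cases rule: ell_relations.cases)
    case (coef_add f g)
    have "finite {w. word [Coef f] w \<noteq> 0}" for f :: "'n mero"
      by (rule finite_subset[of _ "{[Coef f]}"]) (auto simp: word_def)
    then show ?thesis
      unfolding coef_add by (simp add: act_add act_word_eq act_word_Cons act_word_Nil distrib_right)
  next
    case (coef_mult f g)
    show ?thesis
      unfolding coef_mult by (simp add: act_word_eq act_word_Cons act_word_Nil mult.assoc)
  next
    case (coef_const c)
    show ?thesis
      unfolding coef_const by (simp add: act_word_eq act_word_Cons act_word_Nil act_scalar)
  next
    case (var_var i j)
    then have ij: "i \<noteq> j" by simp
    show ?thesis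
    proof (cases "k i = 0 \<or> k j = 0")
      case True
      then show ?thesis
        unfolding var_var using ij
        by (elim disjE) (simp_all add: act_word_eq act_word_Cons act_word_Nil shift_0)
    next
      case False
      let ?H = "dressing_mero q p" and ?M = "m (k(i := k i - 1, j := k j - 1))"
      have "act q p u m k = ?H j * shift q j (?H i * shift q i ?M)"
        unfolding var_var using ij False
        by (simp add: act_word_eq act_word_Cons act_word_Nil fun_upd_twist[of j i])
      also have "\<dots> = (?H j * shift q j (?H i)) * shift q j (shift q i ?M)"
        by (simp add: shift_mult mult.assoc)
      also have "?H j * shift q j (?H i) = weight_mero q p i j * (?H i * shift q i (?H j))"
        using p(2,1) q ij by (rule dressing_mero_cocycle)
      also have "shift q j (shift q i ?M) = shift q i (shift q j ?M)" by (rule shift_commute)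
      also have "weight_mero q p i j * (?H i * shift q i (?H j)) * shift q i (shift q j ?M) =
          weight_mero q p i j * (?H i * shift q i (?H j * shift q j ?M))"
        by (simp add: shift_mult mult.assoc)
      also have "\<dots> = act q p v m k"
        unfolding var_var using ij False by (simp add: act_word_eq act_word_Cons act_word_Nil)
      finally show ?thesis .
    qed
  next
    case (var_coef f i)
    show ?thesis
      unfolding var_coef
      by (simp add: act_word_eq act_word_Cons act_word_Nil shift_mult mult.left_commute)
  qed
qed

section \<open>The algebra as a quotient\<close>

text \<open>The parameters besides \<open>q\<close> and \<open>p\<close> only abbreviate the coefficient field, the free algebra, the
  ideal of relations and their quotient, and tie their types together.\<close>
locale ell_presentation =
  fixes q p :: complex
    and E :: "'n::{finite,linorder} mero ring"
    and F :: "('n gen list \<Rightarrow> complex) ring"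
    and I :: "('n gen list \<Rightarrow> complex) set"
    and A :: "('n mero, ('n gen list \<Rightarrow> complex) set) module" (structure)
  assumes q: "q \<noteq> 0" and p: "p \<noteq> 0" "norm p < 1"
  defines "E \<equiv> ell_field p" and "F \<equiv> ell_free p" and "I \<equiv> ell_ideal q p" and "A \<equiv> ell_algebra q p"
begin

abbreviation coef :: "'n mero \<Rightarrow> ('n gen list \<Rightarrow> complex) set" where
  "coef f \<equiv> ell_gen q p (Coef f)"

abbreviation var :: "'n \<Rightarrow> ('n gen list \<Rightarrow> complex) set" where
  "var i \<equiv> ell_gen q p (Var i)"

definition proj :: "('n gen list \<Rightarrow> complex) \<Rightarrow> ('n gen list \<Rightarrow> complex) set" where
  "proj u = I +>\<^bsub>F\<^esub> u"

lemma F_eq: "F = free_algebra (range Var \<union> Coef ` carrier E)"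
  by (simp add: F_def E_def ell_free_def)

sublocale F: ring F
  unfolding F_eq by (rule ring_free_algebra)

lemma relation_differences: "{u \<ominus>\<^bsub>F\<^esub> v |u v. (u, v) \<in> ell_relations q p} \<subseteq> carrier F"
  using ell_relations_closed[OF q p] F.minus_closed unfolding F_def by blast

sublocale I: ideal I F
  unfolding I_def ell_ideal_def F_def[symmetric]
  by (rule F.genideal_ideal[OF relation_differences])

lemma I_subset_kernel: "I \<subseteq> act_kernel q p"
  unfolding I_def ell_ideal_def F_def[symmetric]
proof (rule F.genideal_minimal)
  show "ideal (act_kernel q p) F" unfolding F_def by (rule ideal_act_kernel)
  show "{u \<ominus>\<^bsub>F\<^esub> v |u v. (u, v) \<in> ell_relations q p} \<subseteq> act_kernel q p"
  proof
    fix z assume "z \<in> {u \<ominus>\<^bsub>F\<^esub> v |u v. (u, v) \<in> ell_relations q p}"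
    then obtain u v where uv: "z = u \<ominus>\<^bsub>F\<^esub> v" "(u, v) \<in> ell_relations q p" by blast
    then have c: "u \<in> carrier F" "v \<in> carrier F"
      using ell_relations_closed[OF q p] unfolding F_def by blast+
    have "act q p z m k = 0" for m k
      using act_minus[of u _ v q p m k] c act_relation[OF q p uv(2)] unfolding uv(1) F_eq by simp
    then show "z \<in> act_kernel q p"
      using c uv(1) F.minus_closed unfolding act_kernel_def F_def by blast
  qed
qed

lemma proj_relation:
  assumes "(u, v) \<in> ell_relations q p"
  shows "proj u = proj v"
proof -
  have "u \<in> carrier F" "v \<in> carrier F"
    using ell_relations_closed[OF q p assms] unfolding F_def by blast+
  moreover have "u \<ominus>\<^bsub>F\<^esub> v \<in> I"
    using F.genideal_self[OF relation_differences] assms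
    unfolding I_def ell_ideal_def F_def[symmetric] by blast
  ultimately show ?thesis
    unfolding proj_def using F.quotient_eq_iff_same_a_r_cos[OF I.ideal_axioms] by blast
qed

lemma A_fields:
  "carrier A = carrier (F Quot I)" "mult A = mult (F Quot I)" "one A = one (F Quot I)"
  "zero A = zero (F Quot I)" "add A = add (F Quot I)"
  "f \<odot> x = coef f \<otimes> x"
  by (simp_all add: A_def F_def I_def ell_algebra_def Let_def)

lemma ring_A: "ring A"
proof -
  interpret Q: ring "F Quot I" by (rule I.quotient_is_ring)
  show ?thesis
  proof (rule ringI)
    show "abelian_group A"
      by (rule abelian_groupI) (simp_all add: A_fields Q.a_ac Q.add.l_inv_ex)
    show "Group.monoid A"
      by (rule Group.monoidI) (auto simp: A_fields Q.m_assoc)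
  qed (auto simp: A_fields Q.l_distr Q.r_distr)
qed

sublocale A: ring A by (rule ring_A)

lemma proj_hom:
  assumes "u \<in> carrier F" "v \<in> carrier F"
  shows "proj u \<in> carrier A" "proj (u \<oplus>\<^bsub>F\<^esub> v) = proj u \<oplus> proj v"
    "proj (u \<otimes>\<^bsub>F\<^esub> v) = proj u \<otimes> proj v"
  using ring_hom_closed[OF I.rcos_ring_hom] ring_hom_add[OF I.rcos_ring_hom]
    ring_hom_mult[OF I.rcos_ring_hom] assms
  by (auto simp: proj_def A_fields)

lemma proj_one: "proj \<one>\<^bsub>F\<^esub> = \<one>"
  using ring_hom_one[OF I.rcos_ring_hom] by (simp add: proj_def A_fields)

lemma proj_zero: "proj \<zero>\<^bsub>F\<^esub> = \<zero>"
  using ring_hom_zero[OF I.rcos_ring_hom F.ring_axioms I.quotient_is_ring]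
  by (simp add: proj_def A_fields)

lemma proj_surj:
  assumes "x \<in> carrier A"
  obtains u where "u \<in> carrier F" "x = proj u"
  using assms unfolding A_fields FactRing_def A_RCOSETS_def' proj_def by auto

lemma coef_word_closed: "f \<in> carrier E \<Longrightarrow> word [Coef f] \<in> carrier F"
  and var_word_closed: "word [Var i] \<in> carrier F"
  unfolding F_eq by (auto intro!: word_closed)

lemma gen_eq: "ell_gen q p x = proj (word [x])"
  by (simp add: ell_gen_def proj_def I_def F_def)

lemma coef_closed [simp]: "f \<in> carrier E \<Longrightarrow> coef f \<in> carrier A"
  unfolding gen_eq by (rule proj_hom) (rule coef_word_closed, assumption)+

lemma var_closed [simp]: "var i \<in> carrier A"
  unfolding gen_eq by (rule proj_hom) (rule var_word_closed)+

lemma coef_add: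
  assumes "f \<in> carrier E" "g \<in> carrier E"
  shows "coef (f + g) = coef f \<oplus> coef g"
proof -
  have "coef (f + g) = proj (\<lambda>w. word [Coef f] w + word [Coef g] w)"
    unfolding gen_eq using assms unfolding E_def by (intro proj_relation ell_relations.coef_add)
  also have "(\<lambda>w. word [Coef f] w + word [Coef g] w) = word [Coef f] \<oplus>\<^bsub>F\<^esub> word [Coef g]"
    unfolding F_eq free_algebra_ops ..
  finally show ?thesis
    unfolding gen_eq using assms by (simp add: proj_hom coef_word_closed)
qed

lemma proj_word_mult:
  assumes "word v \<in> carrier F" "word w \<in> carrier F"
  shows "proj (word (v @ w)) = proj (word v) \<otimes> proj (word w)"
  using proj_hom(3)[OF assms] unfolding F_eq word_mult_word .

lemma coef_mult:
  assumes "f \<in> carrier E" "g \<in> carrier E"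
  shows "coef (f * g) = coef f \<otimes> coef g"
proof -
  have "coef (f * g) = proj (word ([Coef f] @ [Coef g]))"
    unfolding gen_eq append.simps using assms unfolding E_def
    by (intro proj_relation ell_relations.coef_mult)
  then show ?thesis
    using assms by (simp only: proj_word_mult coef_word_closed gen_eq)
qed

lemma coef_const: "coef (const_mero c) = proj (scalar c)"
  unfolding gen_eq by (intro proj_relation ell_relations.coef_const)

lemma coef_1: "coef 1 = \<one>"
proof -
  have "scalar 1 = \<one>\<^bsub>F\<^esub>" unfolding F_eq by (simp add: free_algebra_def scalar_def)
  then show ?thesis using coef_const[of 1] by (simp add: const_mero_1 proj_one)
qed

lemma coef_0: "coef 0 = \<zero>"
proof -
  have "scalar 0 = \<zero>\<^bsub>F\<^esub>" unfolding F_eq by (simp add: free_algebra_def scalar_def)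
  then show ?thesis using coef_const[of 0] by (simp add: const_mero_0 proj_zero)
qed

lemma var_coef:
  assumes "f \<in> carrier E"
  shows "var i \<otimes> coef f = coef (shift q i f) \<otimes> var i"
proof -
  have s: "shift q i f \<in> carrier E" using assms ell_field_shift unfolding E_def by blast
  have "proj (word ([Var i] @ [Coef f])) = proj (word ([Coef (shift q i f)] @ [Var i]))"
    unfolding append.simps using assms unfolding E_def
    by (intro proj_relation ell_relations.var_coef)
  then show ?thesis
    using assms s by (simp only: proj_word_mult coef_word_closed var_word_closed gen_eq)
qed

lemma weight_closed: "i \<noteq> j \<Longrightarrow> weight_mero q p i j \<in> carrier E"
  unfolding E_def by (intro weight_mero_elliptic p q)

lemma var_var:
  assumes "i < j"
  shows "var j \<otimes> var i = coef (weight_mero q p i j) \<otimes> (var i \<otimes> var j)"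
proof -
  have w: "weight_mero q p i j \<in> carrier E" using assms by (intro weight_closed) simp
  have c: "word ([Var i] @ [Var j]) \<in> carrier F" unfolding F_eq by (intro word_closed) auto
  have "proj (word ([Var j] @ [Var i])) =
      proj (word ([Coef (weight_mero q p i j)] @ ([Var i] @ [Var j])))"
    unfolding append.simps using assms by (intro proj_relation ell_relations.var_var)
  also have "\<dots> = coef (weight_mero q p i j) \<otimes> proj (word ([Var i] @ [Var j]))"
    unfolding gen_eq by (rule proj_word_mult[OF coef_word_closed[OF w] c])
  finally show ?thesis
    by (simp only: proj_word_mult coef_word_closed var_word_closed gen_eq)
qed

section \<open>Normal ordering\<close>

lemma shift_closed: "f \<in> carrier E \<Longrightarrow> shift q i f \<in> carrier E"
  unfolding E_def by (rule ell_field_shift)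

lemma shift_pow_closed: "f \<in> carrier E \<Longrightarrow> (shift q i ^^ n) f \<in> carrier E"
  by (induction n) (auto intro: shift_closed)

lemma zero_closed_E: "0 \<in> carrier E" and one_closed_E: "1 \<in> carrier E"
  unfolding E_def by (rule ell_field_0 ell_field_1)+

lemma mult_closed_E: "f \<in> carrier E \<Longrightarrow> g \<in> carrier E \<Longrightarrow> f * g \<in> carrier E"
  unfolding E_def by (rule ell_field_mult)

lemma var_pow_coef:
  assumes f: "f \<in> carrier E"
  shows "var i [^] n \<otimes> coef f = coef ((shift q i ^^ n) f) \<otimes> var i [^] n"
proof (induction n)
  case 0
  show ?case using f by simp
next
  case (Suc n)
  have s: "(shift q i ^^ n) f \<in> carrier E" using f by (rule shift_pow_closed)
  have "var i [^] Suc n \<otimes> coef f = var i \<otimes> (var i [^] n \<otimes> coef f)"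
    using f by (simp only: A.nat_pow_Suc2 A.m_assoc var_closed coef_closed A.nat_pow_closed)
  also have "\<dots> = (var i \<otimes> coef ((shift q i ^^ n) f)) \<otimes> var i [^] n"
    unfolding Suc.IH using s by (simp add: A.m_assoc)
  also have "\<dots> = coef ((shift q i ^^ Suc n) f) \<otimes> (var i \<otimes> var i [^] n)"
    unfolding var_coef[OF s] using shift_closed[OF s] by (simp add: A.m_assoc)
  finally show ?case by (simp only: A.nat_pow_Suc2 var_closed)
qed

lemma var_var_pow:
  assumes "i < j"
  shows "\<exists>c\<in>carrier E. var j \<otimes> var i [^] (n :: nat) = coef c \<otimes> (var i [^] n \<otimes> var j)"
proof (induction n)
  case 0
  show ?case using coef_1 one_closed_E by (intro bexI[of _ 1]) simp_all
next
  case (Suc n)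
  then obtain c where c: "c \<in> carrier E"
    and IH: "var j \<otimes> var i [^] n = coef c \<otimes> (var i [^] n \<otimes> var j)" by blast
  define d where "d = (shift q i ^^ n) (weight_mero q p i j)"
  have w: "weight_mero q p i j \<in> carrier E" using assms by (intro weight_closed) simp
  have d: "d \<in> carrier E" unfolding d_def using w by (rule shift_pow_closed)
  have "var j \<otimes> var i [^] Suc n = (var j \<otimes> var i [^] n) \<otimes> var i"
    by (simp add: A.m_assoc)
  also have "\<dots> = coef c \<otimes> (var i [^] n \<otimes> (var j \<otimes> var i))"
    unfolding IH using c by (simp add: A.m_assoc)
  also have "\<dots> = coef c \<otimes> ((var i [^] n \<otimes> coef (weight_mero q p i j)) \<otimes> (var i \<otimes> var j))"
    unfolding var_var[OF assms] using w by (simp add: A.m_assoc)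
  also have "\<dots> = (coef c \<otimes> coef d) \<otimes> (var i [^] Suc n \<otimes> var j)"
    unfolding var_pow_coef[OF w] d_def[symmetric] using c d by (simp add: A.m_assoc)
  also have "coef c \<otimes> coef d = coef (c * d)" using c d by (simp add: coef_mult)
  finally show ?case using mult_closed_E[OF c d] by blast
qed

definition monomial_on :: "'n list \<Rightarrow> ('n \<Rightarrow> nat) \<Rightarrow> ('n gen list \<Rightarrow> complex) set" where
  "monomial_on l k = foldr (\<lambda>i y. (var i [^] k i) \<otimes> y) l \<one>"

lemma monomial_on_simps:
  "monomial_on [] k = \<one>" "monomial_on (i # l) k = (var i [^] k i) \<otimes> monomial_on l k"
  by (simp_all add: monomial_on_def)

lemma monomial_on_closed [simp]: "monomial_on l k \<in> carrier A"
  by (induction l) (simp_all add: monomial_on_simps)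

lemma monomial_on_cong: "(\<And>i. i \<in> set l \<Longrightarrow> k i = k' i) \<Longrightarrow> monomial_on l k = monomial_on l k'"
  by (induction l) (simp_all add: monomial_on_simps)

lemma ell_monomial_eq: "ell_monomial q p k = monomial_on (sorted_list_of_set UNIV) k"
  by (simp add: ell_monomial_def monomial_on_def A_def)

text \<open>\<open>X\<^sub>j\<close> passes the powers of all smaller variables in the list until it meets its own power, and
  the coefficients that arise on the way are collected on the left.\<close>
lemma var_mult_monomial_on:
  assumes "sorted_wrt (<) l" "j \<in> set l"
  shows "\<exists>c\<in>carrier E. var j \<otimes> monomial_on l k = coef c \<otimes> monomial_on l (k(j := Suc (k j)))"
  using assms
proof (induction l)
  case Nil
  then show ?case by simp
next
  case (Cons i l)
  let ?k = "k(j := Suc (k j))"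
  show ?case
  proof (cases "i = j")
    case True
    with Cons.prems(1) have "monomial_on l k = monomial_on l ?k"
      by (intro monomial_on_cong) auto
    moreover have "var j \<otimes> var j [^] k j = var j [^] Suc (k j)"
      by (rule A.nat_pow_Suc2[symmetric]) simp
    ultimately have "var j \<otimes> monomial_on (i # l) k = coef 1 \<otimes> monomial_on (i # l) ?k"
      using True by (simp add: monomial_on_simps coef_1 A.m_assoc[symmetric] del: A.nat_pow_Suc)
    then show ?thesis using one_closed_E by blast
  next
    case False
    then have ij: "i < j" "j \<in> set l" using Cons.prems by auto
    obtain c where c: "c \<in> carrier E"
      and vc: "var j \<otimes> var i [^] k i = coef c \<otimes> (var i [^] k i \<otimes> var j)"
      using var_var_pow[OF ij(1)] by blast
    obtain d where d: "d \<in> carrier E"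
      and vd: "var j \<otimes> monomial_on l k = coef d \<otimes> monomial_on l ?k"
    proof -
      have "\<exists>c\<in>carrier E. var j \<otimes> monomial_on l k = coef c \<otimes> monomial_on l ?k"
        by (rule Cons.IH) (use Cons.prems(1) ij(2) in simp_all)
      then show ?thesis using that by blast
    qed
    define d' where "d' = (shift q i ^^ k i) d"
    have d': "d' \<in> carrier E" unfolding d'_def using d by (rule shift_pow_closed)
    have "var j \<otimes> monomial_on (i # l) k = (var j \<otimes> var i [^] k i) \<otimes> monomial_on l k"
      by (simp add: monomial_on_simps A.m_assoc)
    also have "\<dots> = coef c \<otimes> (var i [^] k i \<otimes> (var j \<otimes> monomial_on l k))"
      unfolding vc using c by (simp add: A.m_assoc)
    also have "\<dots> = coef c \<otimes> ((var i [^] k i \<otimes> coef d) \<otimes> monomial_on l ?k)"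
      unfolding vd using d by (simp add: A.m_assoc)
    also have "\<dots> = (coef c \<otimes> coef d') \<otimes> (var i [^] k i \<otimes> monomial_on l ?k)"
      unfolding var_pow_coef[OF d] d'_def[symmetric] using c d' by (simp add: A.m_assoc)
    also have "\<dots> = coef (c * d') \<otimes> monomial_on (i # l) ?k"
      using c d' False by (simp add: coef_mult monomial_on_simps)
    finally show ?thesis using mult_closed_E[OF c d'] by blast
  qed
qed

abbreviation monomial :: "('n \<Rightarrow> nat) \<Rightarrow> ('n gen list \<Rightarrow> complex) set" where
  "monomial \<equiv> ell_monomial q p"

lemma monomial_closed [simp]: "monomial k \<in> carrier A"
  by (simp add: ell_monomial_eq)

lemma var_mult_monomial:
  "\<exists>c\<in>carrier E. var j \<otimes> monomial k = coef c \<otimes> monomial (k(j := Suc (k j)))"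
  unfolding ell_monomial_eq by (rule var_mult_monomial_on) auto

lemma monomial_0: "monomial (\<lambda>_. 0) = \<one>"
proof -
  have "monomial_on l (\<lambda>_. 0) = \<one>" for l
    by (induction l) (simp_all add: monomial_on_simps)
  then show ?thesis by (simp add: ell_monomial_eq)
qed

text \<open>The span of the monomials, built up term by term so that its closure properties follow by
  induction.\<close>
inductive_set monomial_span :: "('n gen list \<Rightarrow> complex) set set" where
  zero: "\<zero> \<in> monomial_span"
| add: "f \<in> carrier E \<Longrightarrow> x \<in> monomial_span \<Longrightarrow> (coef f \<otimes> monomial k) \<oplus> x \<in> monomial_span"

lemma monomial_span_closed: "x \<in> monomial_span \<Longrightarrow> x \<in> carrier A"
  by (induction rule: monomial_span.induct) auto

lemma monomial_span_add:
  assumes "x \<in> monomial_span" "y \<in> monomial_span"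
  shows "x \<oplus> y \<in> monomial_span"
  using assms(1)
proof (induction rule: monomial_span.induct)
  case zero
  then show ?case using assms(2) monomial_span_closed by simp
next
  case (add f x k)
  then show ?case
    using monomial_span.add[OF add.hyps(1) add.IH, of k] assms(2) monomial_span_closed
    by (simp add: A.a_assoc)
qed

lemma monomial_span_term: "f \<in> carrier E \<Longrightarrow> coef f \<otimes> monomial k \<in> monomial_span"
  using monomial_span.add[OF _ monomial_span.zero, of f k] by simp

lemma monomial_span_coef_mult:
  assumes "x \<in> monomial_span" "g \<in> carrier E"
  shows "coef g \<otimes> x \<in> monomial_span"
  using assms(1)
proof (induction rule: monomial_span.induct)
  case zero
  then show ?case using assms(2) monomial_span.zero by simp
next
  case (add f x k)
  have "coef g \<otimes> ((coef f \<otimes> monomial k) \<oplus> x) = (coef (g * f) \<otimes> monomial k) \<oplus> (coef g \<otimes> x)"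
    using add.hyps assms(2) monomial_span_closed by (simp add: A.r_distr coef_mult A.m_assoc)
  then show ?case
    using monomial_span.add[OF mult_closed_E[OF assms(2) add.hyps(1)] add.IH] by simp
qed

lemma monomial_span_var_mult:
  assumes "x \<in> monomial_span"
  shows "var i \<otimes> x \<in> monomial_span"
  using assms
proof (induction rule: monomial_span.induct)
  case zero
  then show ?case using monomial_span.zero by simp
next
  case (add f x k)
  obtain c where c: "c \<in> carrier E"
    and vc: "var i \<otimes> monomial k = coef c \<otimes> monomial (k(i := Suc (k i)))"
    using var_mult_monomial by blast
  have s: "shift q i f \<in> carrier E" using add.hyps(1) by (rule shift_closed)
  have "var i \<otimes> (coef f \<otimes> monomial k) = (var i \<otimes> coef f) \<otimes> monomial k"
    using add.hyps(1) by (simp add: A.m_assoc)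
  also have "\<dots> = coef (shift q i f) \<otimes> (var i \<otimes> monomial k)"
    unfolding var_coef[OF add.hyps(1)] using s by (simp add: A.m_assoc)
  also have "\<dots> = coef (shift q i f * c) \<otimes> monomial (k(i := Suc (k i)))"
    unfolding vc using s c by (simp add: A.m_assoc coef_mult)
  finally have "var i \<otimes> ((coef f \<otimes> monomial k) \<oplus> x) =
      (coef (shift q i f * c) \<otimes> monomial (k(i := Suc (k i)))) \<oplus> (var i \<otimes> x)"
    using add.hyps monomial_span_closed by (simp add: A.r_distr)
  then show ?case
    using monomial_span.add[OF mult_closed_E[OF s c] add.IH] by simp
qed

lemma word_mem_F: "word w \<in> carrier F" if "w \<in> lists (range Var \<union> Coef ` carrier E)"
  unfolding F_eq using that by (rule word_closed)

lemma proj_word_in_span: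
  assumes "w \<in> lists (range Var \<union> Coef ` carrier E)"
  shows "proj (word w) \<in> monomial_span"
  using assms
proof (induction w rule: lists.induct)
  case Nil
  have "proj (word []) = coef 1 \<otimes> monomial (\<lambda>_. 0)"
    using proj_one unfolding F_eq free_algebra_ops by (simp add: coef_1 monomial_0)
  then show ?case using monomial_span_term[OF one_closed_E] by simp
next
  case (Cons x w)
  have "word [x] \<in> carrier F" by (rule word_mem_F) (use Cons.hyps(1) in auto)
  then have "proj (word (x # w)) = ell_gen q p x \<otimes> proj (word w)"
    using proj_word_mult[of "[x]" w] word_mem_F[OF Cons.hyps(2)] by (simp add: gen_eq)
  then show ?case
    using Cons.hyps(1) monomial_span_coef_mult[OF Cons.IH] monomial_span_var_mult[OF Cons.IH] by auto
qed

lemma carrier_eq_monomial_span: "carrier A = monomial_span"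
proof
  show "carrier A \<subseteq> monomial_span"
  proof
    fix x assume "x \<in> carrier A"
    then obtain u where u: "u \<in> carrier F" "x = proj u" by (rule proj_surj)
    have "proj u \<in> monomial_span"
      using u(1) unfolding F_eq
    proof (induction rule: free_algebra_induct)
      case zero
      have "proj (\<lambda>w. 0) = \<zero>" using proj_zero unfolding F_eq free_algebra_ops .
      then show ?case using monomial_span.zero by simp
    next
      case (add c w v)
      have E: "const_mero c \<in> carrier E" unfolding E_def by (rule ell_field_const)
      have cl: "scalar c \<in> carrier F" "word w \<in> carrier F" "v \<in> carrier F"
        using add.hyps word_mem_F scalar_closed unfolding F_eq by blast+
      then have "proj ((scalar c \<otimes>\<^bsub>F\<^esub> word w) \<oplus>\<^bsub>F\<^esub> v) =
          (coef (const_mero c) \<otimes> proj (word w)) \<oplus> proj v"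
        by (simp add: proj_hom coef_const)
      also have "\<dots> \<in> monomial_span"
        using monomial_span_coef_mult[OF proj_word_in_span[OF add.hyps(1)] E] add.IH
        by (rule monomial_span_add)
      finally show ?case unfolding F_eq .
    qed
    then show "x \<in> monomial_span" using u(2) by simp
  qed
qed (use monomial_span_closed in blast)

section \<open>Linear combinations of monomials\<close>

lemma fin_coeffs_iff: "c \<in> fin_coeffs E \<longleftrightarrow> (\<forall>k. c k \<in> carrier E) \<and> finite {k. c k \<noteq> 0}"
  by (simp add: fin_coeffs_def E_def ell_field_ops)

text \<open>Enlarging the range of summation beyond the support allows two combinations to be compared.\<close>
lemma lin_comb_superset:
  assumes "c \<in> fin_coeffs E" "finite S" "{k. c k \<noteq> 0} \<subseteq> S"
  shows "lin_comb E A monomial c = (\<Oplus>k\<in>S. coef (c k) \<otimes> monomial k)"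
proof -
  have "lin_comb E A monomial c = (\<Oplus>k\<in>{k. c k \<noteq> 0}. coef (c k) \<otimes> monomial k)"
    unfolding lin_comb_def A_fields(6) by (simp add: E_def ell_field_ops)
  also have "\<dots> = (\<Oplus>k\<in>S. coef (c k) \<otimes> monomial k)"
    by (rule A.add.finprod_mono_neutral_cong_left)
       (use assms in \<open>auto simp: fin_coeffs_iff coef_0\<close>)
  finally show ?thesis .
qed

lemma lin_comb_add_term:
  assumes c: "c \<in> fin_coeffs E" and f: "f \<in> carrier E"
  shows "c(k := f + c k) \<in> fin_coeffs E"
    and "lin_comb E A monomial (c(k := f + c k)) = (coef f \<otimes> monomial k) \<oplus> lin_comb E A monomial c"
proof -
  let ?d = "c(k := f + c k)"
  define S where "S = {j. c j \<noteq> 0} - {k}"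
  have S: "finite S" "k \<notin> S" using c by (auto simp: S_def fin_coeffs_iff)
  have "{j. ?d j \<noteq> 0} \<subseteq> insert k S" by (auto simp: S_def)
  moreover from this have "finite {j. ?d j \<noteq> 0}" by (rule finite_subset) (use S in simp)
  moreover have cE: "c j \<in> carrier E" for j using c by (simp add: fin_coeffs_iff)
  moreover have fc: "f + c k \<in> carrier E" using f cE unfolding E_def by (intro ell_field_add)
  ultimately show d: "?d \<in> fin_coeffs E"
    unfolding fin_coeffs_iff by simp
  let ?R = "\<Oplus>j\<in>S. coef (c j) \<otimes> monomial j"
  have R: "?R \<in> carrier A" by (intro A.finsum_closed) (use cE in auto)
  have "lin_comb E A monomial c = (\<Oplus>j\<in>insert k S. coef (c j) \<otimes> monomial j)"
    by (rule lin_comb_superset[OF c]) (use S in \<open>auto simp: S_def\<close>)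
  also have "\<dots> = (coef (c k) \<otimes> monomial k) \<oplus> ?R"
    using S cE by (intro A.finsum_insert) auto
  finally have lc: "lin_comb E A monomial c = (coef (c k) \<otimes> monomial k) \<oplus> ?R" .
  have "lin_comb E A monomial ?d = (\<Oplus>j\<in>insert k S. coef (?d j) \<otimes> monomial j)"
    by (rule lin_comb_superset[OF d]) (use S in \<open>auto simp: S_def\<close>)
  also have "\<dots> = (coef (f + c k) \<otimes> monomial k) \<oplus> (\<Oplus>j\<in>S. coef (?d j) \<otimes> monomial j)"
    using S cE fc by (subst A.finsum_insert) auto
  also have "(\<Oplus>j\<in>S. coef (?d j) \<otimes> monomial j) = ?R"
    by (rule A.finsum_cong') (use S cE in auto)
  also have "coef (f + c k) \<otimes> monomial k = (coef f \<otimes> monomial k) \<oplus> (coef (c k) \<otimes> monomial k)"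
    using f cE by (simp add: coef_add A.l_distr)
  finally have ld: "lin_comb E A monomial ?d =
      ((coef f \<otimes> monomial k) \<oplus> (coef (c k) \<otimes> monomial k)) \<oplus> ?R" .
  show "lin_comb E A monomial ?d = (coef f \<otimes> monomial k) \<oplus> lin_comb E A monomial c"
    unfolding ld lc using f cE R by (intro A.a_assoc) auto
qed

lemma lin_comb_exists:
  assumes "x \<in> carrier A"
  shows "\<exists>c\<in>fin_coeffs E. x = lin_comb E A monomial c"
  using assms unfolding carrier_eq_monomial_span
proof (induction rule: monomial_span.induct)
  case zero
  have "(\<lambda>_. 0) \<in> fin_coeffs E" by (simp add: fin_coeffs_iff zero_closed_E)
  moreover from this have "lin_comb E A monomial (\<lambda>_. 0) = \<zero>"
    using lin_comb_superset[of "\<lambda>_. 0" "{}"] by simp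
  ultimately show ?case by metis
next
  case (add f x k)
  then obtain c where "c \<in> fin_coeffs E" "x = lin_comb E A monomial c" by blast
  then show ?case using lin_comb_add_term[OF _ add.hyps(1), of c k] by metis
qed

section \<open>Coordinates\<close>

text \<open>The action of a representative. The choice is irrelevant because the ideal acts as zero, see
  \<open>quot_act_proj\<close>.\<close>
definition quot_act ::
    "('n gen list \<Rightarrow> complex) set \<Rightarrow> (('n \<Rightarrow> nat) \<Rightarrow> 'n mero) \<Rightarrow> ('n \<Rightarrow> nat) \<Rightarrow> 'n mero" where
  "quot_act x = act q p (SOME u. u \<in> carrier F \<and> proj u = x)"

lemma quot_act_proj:
  assumes u: "u \<in> carrier F"
  shows "quot_act (proj u) = act q p u"
proof -
  define v where "v = (SOME v. v \<in> carrier F \<and> proj v = proj u)"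
  have v: "v \<in> carrier F" "proj v = proj u"
    using someI[of "\<lambda>v. v \<in> carrier F \<and> proj v = proj u" u] u unfolding v_def by auto
  then have "v \<ominus>\<^bsub>F\<^esub> u \<in> I"
    using F.quotient_eq_iff_same_a_r_cos[OF I.ideal_axioms v(1) u] unfolding proj_def by simp
  then have "act q p (v \<ominus>\<^bsub>F\<^esub> u) m k = 0" for m k
    using I_subset_kernel unfolding act_kernel_def by blast
  then have "act q p v m k = act q p u m k" for m k
    using act_minus v(1) u unfolding F_eq by fastforce
  then show ?thesis unfolding quot_act_def v_def[symmetric] by (intro ext)
qed

lemma quot_act_add:
  assumes "x \<in> carrier A" "y \<in> carrier A"
  shows "quot_act (x \<oplus> y) m k = quot_act x m k + quot_act y m k"
proof -
  obtain u v where uv: "u \<in> carrier F" "x = proj u" "v \<in> carrier F" "y = proj v"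
    using assms proj_surj by metis
  then have fin: "finite {w. u w \<noteq> 0}" "finite {w. v w \<noteq> 0}"
    using free_algebra_finite_support unfolding F_eq by blast+
  have "x \<oplus> y = proj (u \<oplus>\<^bsub>F\<^esub> v)" using uv by (simp add: proj_hom)
  then have "quot_act (x \<oplus> y) m k = act q p (u \<oplus>\<^bsub>F\<^esub> v) m k"
    using quot_act_proj[OF F.a_closed] uv by simp
  also have "\<dots> = act q p u m k + act q p v m k"
    unfolding F_eq free_algebra_ops using fin by (rule act_add)
  finally show ?thesis using quot_act_proj uv by simp
qed

lemma quot_act_mult:
  assumes "x \<in> carrier A" "y \<in> carrier A"
  shows "quot_act (x \<otimes> y) m = quot_act x (quot_act y m)"
proof -
  obtain u v where uv: "u \<in> carrier F" "x = proj u" "v \<in> carrier F" "y = proj v"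
    using assms proj_surj by metis
  then have fin: "finite {w. u w \<noteq> 0}" "finite {w. v w \<noteq> 0}"
    using free_algebra_finite_support unfolding F_eq by blast+
  have "x \<otimes> y = proj (u \<otimes>\<^bsub>F\<^esub> v)" using uv by (simp add: proj_hom)
  then have "quot_act (x \<otimes> y) m = act q p (u \<otimes>\<^bsub>F\<^esub> v) m"
    using quot_act_proj[OF F.m_closed] uv by simp
  also have "\<dots> = act q p u (act q p v m)"
    unfolding F_eq free_algebra_ops using fin by (rule act_mult)
  finally show ?thesis using quot_act_proj uv by simp
qed

lemma quot_act_zero: "quot_act \<zero> m k = 0"
proof -
  have "quot_act (proj \<zero>\<^bsub>F\<^esub>) = act q p \<zero>\<^bsub>F\<^esub>" by (rule quot_act_proj) simp
  then show ?thesis unfolding proj_zero unfolding F_eq free_algebra_ops by (simp add: act_zero)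
qed

lemma quot_act_one: "quot_act \<one> m = m"
proof -
  have "quot_act (proj \<one>\<^bsub>F\<^esub>) = act q p \<one>\<^bsub>F\<^esub>" by (rule quot_act_proj) simp
  then show ?thesis
    unfolding proj_one unfolding F_eq free_algebra_ops
    by (simp add: fun_eq_iff act_word_eq act_word_Nil)
qed

lemma quot_act_gen:
  assumes "word [x] \<in> carrier F"
  shows "quot_act (ell_gen q p x) m = act_gen q p x m"
  unfolding gen_eq quot_act_proj[OF assms]
  by (simp add: fun_eq_iff act_word_eq act_word_Cons act_word_Nil)

text \<open>The term \<open>g z\<^sup>k\<close>.\<close>
definition delta :: "('n \<Rightarrow> nat) \<Rightarrow> 'n mero \<Rightarrow> ('n \<Rightarrow> nat) \<Rightarrow> 'n mero" where
  "delta k g = (\<lambda>k'. if k' = k then g else 0)"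

lemma quot_act_var_delta:
  "quot_act (var i) (delta k g) = delta (k(i := Suc (k i))) (dressing_mero q p i * shift q i g)"
proof (rule ext)
  fix k' :: "'n \<Rightarrow> nat"
  have "k'(i := k' i - 1) = k \<longleftrightarrow> k' = k(i := Suc (k i))" if "k' i \<noteq> 0"
    using that by (auto simp: fun_eq_iff)
  then show "quot_act (var i) (delta k g) k' =
      delta (k(i := Suc (k i))) (dressing_mero q p i * shift q i g) k'"
    unfolding quot_act_gen[OF var_word_closed] by (auto simp: delta_def shift_0)
qed

lemma quot_act_var_pow_delta:
  assumes "g dvd 1"
  shows "\<exists>h. h dvd 1 \<and> quot_act (var i [^] (n :: nat)) (delta k g) = delta (k(i := k i + n)) h"
proof (induction n)
  case 0
  show ?case using assms by (intro exI[of _ g]) (simp add: quot_act_one)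
next
  case (Suc n)
  then obtain h where h: "h dvd 1" "quot_act (var i [^] n) (delta k g) = delta (k(i := k i + n)) h"
    by blast
  have "var i [^] Suc n = var i \<otimes> var i [^] n" by (rule A.nat_pow_Suc2) simp
  then have "quot_act (var i [^] Suc n) (delta k g) =
      delta (k(i := k i + Suc n)) (dressing_mero q p i * shift q i h)"
    by (simp add: quot_act_mult h(2) quot_act_var_delta del: A.nat_pow_Suc)
  moreover have "dressing_mero q p i * shift q i h dvd 1"
    using mult_dvd_mono[OF dressing_mero_unit[OF p(2) q] shift_unit[OF h(1)]] by simp
  ultimately show ?case by blast
qed

lemma quot_act_monomial_on:
  assumes "distinct l"
  shows "\<exists>g. g dvd 1 \<and> quot_act (monomial_on l k) (delta (\<lambda>_. 0) 1) =
    delta (\<lambda>i. if i \<in> set l then k i else 0) g"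
  using assms
proof (induction l)
  case Nil
  show ?case by (intro exI[of _ 1]) (simp add: monomial_on_simps quot_act_one)
next
  case (Cons i l)
  let ?k = "\<lambda>j. if j \<in> set l then k j else 0"
  obtain g where g: "g dvd 1" "quot_act (monomial_on l k) (delta (\<lambda>_. 0) 1) = delta ?k g"
    using Cons by auto
  obtain h where h: "h dvd 1" "quot_act (var i [^] k i) (delta ?k g) = delta (?k(i := ?k i + k i)) h"
    using quot_act_var_pow_delta[OF g(1)] by blast
  have "?k(i := ?k i + k i) = (\<lambda>j. if j \<in> set (i # l) then k j else 0)"
    using Cons.prems by (auto simp: fun_eq_iff)
  then show ?case
    using h by (auto simp: monomial_on_simps quot_act_mult g(2))
qed

lemma quot_act_monomial:
  "\<exists>g. \<forall>k. g k dvd 1 \<and> quot_act (monomial k) (delta (\<lambda>_. 0) 1) = delta k (g k)"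
proof (intro choice allI)
  show "\<exists>g. g dvd 1 \<and> quot_act (monomial k) (delta (\<lambda>_. 0) 1) = delta k g" for k
    using quot_act_monomial_on[of "sorted_list_of_set UNIV" k] by (simp add: ell_monomial_eq)
qed

text \<open>The \<open>k\<close>-th coefficient, multiplied by a unit that depends on \<open>k\<close> only, is the coefficient of
  \<open>z\<^sup>k\<close> in the image of \<open>z\<^sup>0\<close>.\<close>
lemma lin_comb_inj:
  assumes c: "c \<in> fin_coeffs E" and d: "d \<in> fin_coeffs E"
    and eq: "lin_comb E A monomial c = lin_comb E A monomial d"
  shows "c = d"
proof
  fix k
  obtain g where g: "\<And>k. g k dvd 1"
    "\<And>k. quot_act (monomial k) (delta (\<lambda>_. 0) 1) = delta k (g k)"
    using quot_act_monomial by blast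
  have coord: "quot_act (lin_comb E A monomial c) (delta (\<lambda>_. 0) 1) k = c k * g k"
    if c: "c \<in> fin_coeffs E" for c
  proof -
    have cE: "c j \<in> carrier E" for j using c by (simp add: fin_coeffs_iff)
    have sum: "quot_act (\<Oplus>j\<in>S. coef (c j) \<otimes> monomial j) (delta (\<lambda>_. 0) 1) k =
        (if k \<in> S then c k * g k else 0)" if "finite S" for S
      using that
    proof (induction S rule: finite_induct)
      case empty
      then show ?case by (simp add: quot_act_zero)
    next
      case (insert j S)
      have "(\<Oplus>j\<in>insert j S. coef (c j) \<otimes> monomial j) =
          (coef (c j) \<otimes> monomial j) \<oplus> (\<Oplus>j\<in>S. coef (c j) \<otimes> monomial j)"
        using insert.hyps cE by (intro A.finsum_insert) auto
      moreover have "(\<Oplus>j\<in>S. coef (c j) \<otimes> monomial j) \<in> carrier A"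
        by (intro A.finsum_closed) (use cE in auto)
      moreover have "quot_act (coef (c j) \<otimes> monomial j) (delta (\<lambda>_. 0) 1) k =
          (if k = j then c k * g k else 0)"
        using cE by (simp add: quot_act_mult g(2) quot_act_gen coef_word_closed) (simp add: delta_def)
      ultimately show ?case
        using insert cE by (auto simp: quot_act_add)
    qed
    have "lin_comb E A monomial c = (\<Oplus>j\<in>insert k {j. c j \<noteq> 0}. coef (c j) \<otimes> monomial j)"
      using c by (intro lin_comb_superset) (auto simp: fin_coeffs_iff)
    then show ?thesis
      using sum[of "insert k {j. c j \<noteq> 0}"] c by (simp add: fin_coeffs_iff)
  qed
  obtain h where h: "g k * h = 1" using g(1)[of k] by (metis dvdE)
  have "c k * g k = d k * g k" using coord[OF c] coord[OF d] eq by simp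
  then have "c k * (g k * h) = d k * (g k * h)" by (metis mult.assoc)
  then show "c k = d k" by (simp add: h)
qed

lemma module_A: "module E A"
proof (rule moduleI)
  show "cring E" unfolding E_def by (rule cring_ell_field)
  show "abelian_group A" by (rule A.is_abelian_group)
qed (auto simp: A_fields(6) coef_1 coef_add[unfolded E_def] coef_mult[unfolded E_def] E_def ell_field_ops
    A.l_distr A.r_distr A.m_assoc coef_closed[unfolded E_def])

lemma monomial_basis: "module_basis E A monomial"
  unfolding module_basis_def
proof (intro conjI ballI impI allI)
  show "module E A" by (rule module_A)
  show "range monomial \<subseteq> carrier A" by auto
  show "\<exists>c\<in>fin_coeffs E. x = lin_comb E A monomial c" if "x \<in> carrier A" for x
    using that by (rule lin_comb_exists)
next
  fix c k assume c: "c \<in> fin_coeffs E" "lin_comb E A monomial c = \<zero>"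
  have z: "(\<lambda>_. 0) \<in> fin_coeffs E" by (simp add: fin_coeffs_iff zero_closed_E)
  then have "lin_comb E A monomial (\<lambda>_. 0) = \<zero>"
    using lin_comb_superset[of "\<lambda>_. 0" "{}"] by simp
  then have "c = (\<lambda>_. 0)" using c by (intro lin_comb_inj z) simp_all
  then show "c k = \<zero>\<^bsub>E\<^esub>" by (simp add: E_def ell_field_ops)
qed

end

theorem proposition3p2:
  fixes q p :: complex
  assumes "q \<noteq> 0" and "p \<noteq> 0" and "norm p < 1"
  defines "E \<equiv> ell_field p :: 'n::{finite,linorder} mero ring"
    and "A \<equiv> ell_algebra q p"
    and "X \<equiv> ell_monomial q p :: ('n \<Rightarrow> nat) \<Rightarrow> _"
  shows "module_basis E A X \<and>
    (\<forall>x\<in>carrier A. \<exists>!c. c \<in> fin_coeffs E \<and> x = lin_comb E A X c)"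
proof -
  interpret ell_presentation q p E "ell_free p" "ell_ideal q p" A
    unfolding E_def A_def by unfold_locales (use assms in auto)
  show ?thesis
    unfolding X_def using monomial_basis lin_comb_exists lin_comb_inj by metis
qed

end
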